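(* Let $n,k$ be positive integers with $n\ge\binom{k+1}{2}$, let $[\alpha_1|\beta_1],[\alpha_2|\beta_2]\in S\text{-}Block(n)$, and write $M=[\alpha_1|\beta_1]\wedge[\alpha_2|\beta_2]$ and $J=[\alpha_1|\beta_1]\vee[\alpha_2|\beta_2]$ for the meet and join in the lattice $S\text{-}Block(n)\cup\{\hat0,\hat1\}$. Then: (1) For $i\in\{1,2\}$, if $[\alpha_1|\beta_1],[\alpha_2|\beta_2]\in NG_i(n,k)$, then $M\in NG_i(n,k)$, and $J\in NG_i(n,k)$ or $J=\hat1$. (2) For $i\in\{1,2\}$, if $[\alpha_1|\beta_1],[\alpha_2|\beta_2]\in NG_i^*(n,k)$, then $M\in NG_i^*(n,k)$, and $J\in NG_i^*(n,k)$ or $J=\hat1$. (3) If $[\alpha_1|\beta_1]\in NG_1^*(n,k)$ and $[\alpha_2|\beta_2]\in NG_2^*(n,k)$, then $M\in NG_1(n,k)\cap NG_2(n,k)$ and $J=\hat1$. Moreover, in each of these cases, $J=\hat1$ if and only if $(\beta_1\wedge\beta_2)\not\succeq(\alpha_1\vee\alpha_2)$.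
   Context: $Dis(n)$ is the set of partitions $\gamma=(g_1,\dots,g_r)$ of $n$ into distinct positive parts $g_1>\dots>g_r>0$, with $\mathrm{len}(\gamma)=r$; $Dis_k(n)$ is the subset of those with exactly $k$ parts. For $\gamma=(g_1,\dots,g_r)$ and $\delta=(d_1,\dots,d_s)$ in $Dis(n)$, $\delta\succeq\gamma$ ($\delta$ majorizes $\gamma$) means $\sum_{i=1}^m d_i\ge\sum_{i=1}^m g_i$ for all $m\le\min\{r,s\}$. $Dis(n)$ is a lattice under this order; $\gamma\wedge\delta$, $\gamma\vee\delta$ for partitions denote meet and join in $Dis(n)$. An $S$-block is an ordered pair $[\alpha|\beta]$ with $\alpha,\beta\in Dis(n)$, $\beta\succeq\alpha$, and $\mathrm{len}(\alpha)\in\{\mathrm{len}(\beta),\mathrm{len}(\beta)+1\}$. $S\text{-}Block(n)$ is the poset of all such $S$-blocks, ordered by $[\alpha_1|\beta_1]\succeq[\alpha_2|\beta_2]$ iff $\alpha_1\succeq\alpha_2$ and $\beta_1\preceq\beta_2$. Adding a new minimum element $\hat0$ and a new maximum element $\hat1$ gives a lattice $S\text{-}Block(n)\cup\{\hat0,\hat1\}$. $A(n,k)$ is the set of $S$-blocks $[\alpha|\beta]$ with $\alpha,\beta\in Dis_k(n)$. Graphs are finite and simple, without isolated vertices. For a degree sequence $\pi=(d_1\ge\dots\ge d_r)$, $\alpha(\pi)$ has $i$-th part $d_i-i+1$ for those $i$ with $d_i\ge i$, and $\beta(\pi)$ has $j$-th part $|\{i:d_i\ge j\}|-j$ for those $j$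 for which this is positive. A graph $G$ is an NG-graph if $\chi(G)+\chi(\overline G)=|V(G)|+1$. With $A_G=\{v:\deg(v)=\chi(G)-1\}$, an NG-graph is NG-1 if $G[A_G]$ is a clique and NG-2 if $G[A_G]$ is a stable set. An $S$-block $[\alpha|\beta]$ is called NG-1 (resp. NG-2) if there is an NG-1 (resp. NG-2) graph with degree sequence $\pi$ such that $\alpha=\alpha(\pi)$, $\beta=\beta(\pi)$. $NG_1(n,k)$ (resp. $NG_2(n,k)$) is the subset of $A(n,k)$ consisting of its NG-1 (resp. NG-2) $S$-blocks. $NG_1^*(n,k)=NG_1(n,k)\setminus NG_2(n,k)$ and $NG_2^*(n,k)=NG_2(n,k)\setminus NG_1(n,k)$. *)

theory Defs
  imports "HOL-Algebra.Lattice" "HOL-Library.Multiset"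
begin

section \<open>Partitions into distinct parts\<close>

text \<open>A partition is the list of its parts in decreasing order; \<open>len\<close> is \<open>length\<close>.\<close>

definition Dis :: "nat \<Rightarrow> nat list set" where
  "Dis n = {\<gamma>. sorted_wrt (>) \<gamma> \<and> (\<forall>g\<in>set \<gamma>. g > 0) \<and> sum_list \<gamma> = n}"

definition Dis_k :: "nat \<Rightarrow> nat \<Rightarrow> nat list set" where
  "Dis_k k n = {\<gamma> \<in> Dis n. length \<gamma> = k}"

definition majorizes :: "nat list \<Rightarrow> nat list \<Rightarrow> bool" (infix \<open>\<succeq>\<close> 50) where
  "\<delta> \<succeq> \<gamma> \<longleftrightarrow>
     (\<forall>m \<le> min (length \<gamma>) (length \<delta>). sum_list (take m \<delta>) \<ge> sum_list (take m \<gamma>))"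

definition Dis_order :: "nat \<Rightarrow> nat list gorder" where
  "Dis_order n = \<lparr>carrier = Dis n, eq = (=), le = (\<lambda>\<gamma> \<delta>. \<delta> \<succeq> \<gamma>)\<rparr>"


section \<open>S-blocks\<close>

text \<open>The block \<open>[\<alpha>|\<beta>]\<close> is the pair \<open>(\<alpha>, \<beta>)\<close>.\<close>

type_synonym block = "nat list \<times> nat list"

definition S_Block :: "nat \<Rightarrow> block set" where
  "S_Block n = {(\<alpha>, \<beta>). \<alpha> \<in> Dis n \<and> \<beta> \<in> Dis n \<and> \<beta> \<succeq> \<alpha> \<and>
     (length \<alpha> = length \<beta> \<or> length \<alpha> = length \<beta> + 1)}"

fun block_le :: "block \<Rightarrow> block \<Rightarrow> bool" where
  "block_le (\<alpha>\<^sub>2, \<beta>\<^sub>2) (\<alpha>\<^sub>1, \<beta>\<^sub>1) \<longleftrightarrow> \<alpha>\<^sub>1 \<succeq> \<alpha>\<^sub>2 \<and> \<beta>\<^sub>2 \<succeq> \<beta>\<^sub>1"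

datatype 'a hatted = Hat0 | Elem 'a | Hat1

fun hatted_le :: "('a \<Rightarrow> 'a \<Rightarrow> bool) \<Rightarrow> 'a hatted \<Rightarrow> 'a hatted \<Rightarrow> bool" where
  "hatted_le r Hat0 y = True"
| "hatted_le r x Hat1 = True"
| "hatted_le r (Elem x) (Elem y) = r x y"
| "hatted_le r _ _ = False"

definition S_Block_order :: "nat \<Rightarrow> block hatted gorder" where
  "S_Block_order n =
     \<lparr>carrier = Elem ` S_Block n \<union> {Hat0, Hat1}, eq = (=), le = hatted_le block_le\<rparr>"

definition A_block :: "nat \<Rightarrow> nat \<Rightarrow> block set" where
  "A_block n k = {(\<alpha>, \<beta>) \<in> S_Block n. \<alpha> \<in> Dis_k k n \<and> \<beta> \<in> Dis_k k n}"


section \<open>Graphs\<close>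

text \<open>
  Edges are two-element sets of vertices. Isolated vertices are excluded only where the
  NG-graphs realizing a block are introduced, since the complement of such a graph may have some.
\<close>

definition simple_graph :: "'a set \<Rightarrow> 'a set set \<Rightarrow> bool" where
  "simple_graph V E \<longleftrightarrow> finite V \<and> (\<forall>e\<in>E. e \<subseteq> V \<and> card e = 2)"

definition degree :: "'a set set \<Rightarrow> 'a \<Rightarrow> nat" where
  "degree E v = card {e \<in> E. v \<in> e}"

definition complement_edges :: "'a set \<Rightarrow> 'a set set \<Rightarrow> 'a set set" where
  "complement_edges V E = {e. e \<subseteq> V \<and> card e = 2 \<and> e \<notin> E}"

definition proper_coloring :: "'a set \<Rightarrow> 'a set set \<Rightarrow> nat \<Rightarrow> ('a \<Rightarrow> nat) \<Rightarrow> bool" where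
  "proper_coloring V E k c \<longleftrightarrow>
     (\<forall>v\<in>V. c v < k) \<and> (\<forall>u\<in>V. \<forall>v\<in>V. {u, v} \<in> E \<longrightarrow> c u \<noteq> c v)"

definition chromatic_number :: "'a set \<Rightarrow> 'a set set \<Rightarrow> nat" where
  "chromatic_number V E = (LEAST k. \<exists>c. proper_coloring V E k c)"

definition clique :: "'a set set \<Rightarrow> 'a set \<Rightarrow> bool" where
  "clique E A \<longleftrightarrow> (\<forall>u\<in>A. \<forall>v\<in>A. u \<noteq> v \<longrightarrow> {u, v} \<in> E)"

definition stable_set :: "'a set set \<Rightarrow> 'a set \<Rightarrow> bool" where
  "stable_set E A \<longleftrightarrow> (\<forall>u\<in>A. \<forall>v\<in>A. {u, v} \<notin> E)"

definition degree_sequence :: "'a set \<Rightarrow> 'a set set \<Rightarrow> nat list" where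
  "degree_sequence V E =
     rev (sorted_list_of_multiset (image_mset (degree E) (mset_set V)))"

text \<open>
  With \<open>d\<^sub>i = \<pi> ! (i - 1)\<close>, the index \<open>i\<close> below is one less than the customary one, so that
  \<open>d\<^sub>i \<ge> i\<close> and \<open>d\<^sub>i - i + 1\<close> become \<open>i < \<pi> ! i\<close> and \<open>\<pi> ! i - i\<close>.
\<close>

definition alpha_of :: "nat list \<Rightarrow> nat list" where
  "alpha_of \<pi> = map (\<lambda>i. \<pi> ! i - i) (filter (\<lambda>i. i < \<pi> ! i) [0..<length \<pi>])"

definition conj_part :: "nat list \<Rightarrow> nat \<Rightarrow> nat" where
  "conj_part \<pi> j = card {i. i < length \<pi> \<and> j \<le> \<pi> ! i}"

text \<open>
  Here \<open>j\<close> counts from 1, and \<open>conj_part \<pi> j - j\<close> can be positive only for \<open>j < length \<pi>\<close>.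
\<close>

definition beta_of :: "nat list \<Rightarrow> nat list" where
  "beta_of \<pi> =
     map (\<lambda>j. conj_part \<pi> j - j) (filter (\<lambda>j. j < conj_part \<pi> j) [1..<length \<pi> + 1])"


section \<open>NG-graphs and NG-blocks\<close>

definition NG_graph :: "'a set \<Rightarrow> 'a set set \<Rightarrow> bool" where
  "NG_graph V E \<longleftrightarrow> simple_graph V E \<and> (\<forall>v\<in>V. degree E v > 0) \<and>
     chromatic_number V E + chromatic_number V (complement_edges V E) = card V + 1"

definition A_set :: "'a set \<Rightarrow> 'a set set \<Rightarrow> 'a set" where
  "A_set V E = {v \<in> V. degree E v = chromatic_number V E - 1}"

definition NG1_graph :: "'a set \<Rightarrow> 'a set set \<Rightarrow> bool" where
  "NG1_graph V E \<longleftrightarrow> NG_graph V E \<and> clique E (A_set V E)"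

definition NG2_graph :: "'a set \<Rightarrow> 'a set set \<Rightarrow> bool" where
  "NG2_graph V E \<longleftrightarrow> NG_graph V E \<and> stable_set E (A_set V E)"

text \<open>Every finite graph is isomorphic to one whose vertices are natural numbers.\<close>

definition NG1_block :: "block \<Rightarrow> bool" where
  "NG1_block b \<longleftrightarrow> (\<exists>(V :: nat set) E. NG1_graph V E \<and>
     b = (alpha_of (degree_sequence V E), beta_of (degree_sequence V E)))"

definition NG2_block :: "block \<Rightarrow> bool" where
  "NG2_block b \<longleftrightarrow> (\<exists>(V :: nat set) E. NG2_graph V E \<and>
     b = (alpha_of (degree_sequence V E), beta_of (degree_sequence V E)))"

definition NG1 :: "nat \<Rightarrow> nat \<Rightarrow> block set" where
  "NG1 n k = {b \<in> A_block n k. NG1_block b}"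

definition NG2 :: "nat \<Rightarrow> nat \<Rightarrow> block set" where
  "NG2 n k = {b \<in> A_block n k. NG2_block b}"

definition NG1_star :: "nat \<Rightarrow> nat \<Rightarrow> block set" where
  "NG1_star n k = NG1 n k - NG2 n k"

definition NG2_star :: "nat \<Rightarrow> nat \<Rightarrow> block set" where
  "NG2_star n k = NG2 n k - NG1 n k"

end

theory Submission
  imports Defs
begin

text \<open>
  For \<open>k > 0\<close>, whether a block \<open>[\<alpha>|\<beta>]\<close> of \<open>A_block n k\<close> is NG-1 or NG-2 depends only on the smallest
  parts: it is NG-1 iff the smallest part of \<open>\<beta>\<close> is \<open>1\<close>, and NG-2 iff the smallest part of \<open>\<alpha>\<close> is at
  least \<open>2\<close> (\<open>NG1_iff\<close>, \<open>NG2_iff\<close>). On partitions with \<open>k\<close> parts, the meet takes the maximum and the join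
  the minimum of the smallest parts, and both have \<open>k\<close> parts again (\<open>Dis_k_meet\<close>, \<open>Dis_k_join\<close>). The
  meet of two blocks is \<open>[\<alpha>\<^sub>1 \<sqinter> \<alpha>\<^sub>2|\<beta>\<^sub>1 \<squnion> \<beta>\<^sub>2]\<close>, and the join is \<open>[\<alpha>\<^sub>1 \<squnion> \<alpha>\<^sub>2|\<beta>\<^sub>1 \<sqinter> \<beta>\<^sub>2]\<close> if this is a block
  and the new maximum otherwise (\<open>block_meet\<close>, \<open>block_join\<close>). What remains is to compare minima and
  maxima of four numbers, using that the smallest part of \<open>\<beta>\<close> is at most that of \<open>\<alpha>\<close> in every block.

  To see that the conditions are necessary, let the block of the degree sequence of an NG-graph have
  \<open>k\<close> parts on both sides. Then at most \<open>k\<close> vertices have degree above \<open>k\<close>, and more than \<open>k\<close> vertices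
  have degree at least \<open>k\<close>. Greedy colouring bounds the chromatic numbers of the graph and of its
  complement by \<open>k + 1\<close> and \<open>|V| - k\<close>. The defining equation of NG-graphs makes these bounds exact
  (\<open>NG_chromatic_numbers\<close>), so \<open>A_set\<close> consists of the vertices of degree \<open>k\<close>. If these form a clique,
  they can share a colour in the complement, which contradicts exactness unless exactly \<open>k + 1\<close>
  vertices have degree at least \<open>k\<close>; this number minus \<open>k\<close> is the smallest part of \<open>\<beta>\<close>. If they are
  stable, they can share a colour in the graph itself, which forces exactly \<open>k\<close> vertices to have degree
  above \<open>k\<close>, and the smallest part of \<open>\<alpha>\<close> is at least \<open>2\<close>.

  Conversely, every block of \<open>A_block n k\<close> is realized by a split graph (\<open>split_realization\<close>):
  majorization of \<open>\<alpha>\<close> by \<open>\<beta>\<close> is precisely what the Gale-Ryser theorem needs to join a clique on \<open>k\<close>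
  vertices to a stable set with the right degrees. This split graph is an NG-graph, and its vertices of
  degree \<open>k\<close> form a clique or a stable set as the smallest parts require (\<open>NG_block_of_last\<close>).
\<close>

section \<open>Partial sums of partitions into distinct parts\<close>

definition psum :: "nat list \<Rightarrow> nat \<Rightarrow> nat" where
  "psum \<gamma> m = sum_list (take m \<gamma>)"

lemma psum_0 [simp]: "psum \<gamma> 0 = 0"
  by (simp add: psum_def)

lemma psum_Suc: "m < length \<gamma> \<Longrightarrow> psum \<gamma> (Suc m) = psum \<gamma> m + \<gamma> ! m"
  by (simp add: psum_def take_Suc_conv_app_nth)

lemma psum_beyond: "length \<gamma> \<le> m \<Longrightarrow> psum \<gamma> m = sum_list \<gamma>"
  by (simp add: psum_def)

lemma psum_mono: "m \<le> m' \<Longrightarrow> psum \<gamma> m \<le> psum \<gamma> m'"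
  by (metis le_add1 le_add_diff_inverse psum_def sum_list_append take_add)

lemma psum_le_sum_list: "psum \<gamma> m \<le> sum_list \<gamma>"
  by (metis append_take_drop_id le_add1 psum_def sum_list_append)

lemma Dis_psum_le: "\<gamma> \<in> Dis n \<Longrightarrow> psum \<gamma> m \<le> n"
  using psum_le_sum_list by (auto simp: Dis_def)

lemma Dis_psum_eq_iff:
  assumes "\<gamma> \<in> Dis n"
  shows "psum \<gamma> m = n \<longleftrightarrow> length \<gamma> \<le> m"
proof (cases "m < length \<gamma>")
  case True
  then have "\<gamma> ! m > 0"
    using assms by (auto simp: Dis_def)
  then have "psum \<gamma> m < psum \<gamma> (Suc m)"
    using psum_Suc[OF True] by simp
  then show ?thesis
    using Dis_psum_le[OF assms, of "Suc m"] True by simp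
qed (use assms in \<open>auto simp: Dis_def psum_beyond\<close>)

lemma Dis_psum_less_iff: "\<gamma> \<in> Dis n \<Longrightarrow> psum \<gamma> m < n \<longleftrightarrow> m < length \<gamma>"
  using Dis_psum_eq_iff[of \<gamma> n m] Dis_psum_le[of \<gamma> n m] by linarith

text \<open>
  The comparison up to the smaller length extends to all indices because a majorizing partition
  of the same number cannot have more parts: its partial sums would have to reach \<open>n\<close> before all
  of its parts are used. Majorization thus is the pointwise order of partial sums.
\<close>

lemma majorizes_iff_psum:
  assumes "\<gamma> \<in> Dis n" "\<delta> \<in> Dis n"
  shows "\<delta> \<succeq> \<gamma> \<longleftrightarrow> (\<forall>m. psum \<gamma> m \<le> psum \<delta> m)"
proof
  assume maj: "\<delta> \<succeq> \<gamma>"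
  have le: "psum \<gamma> m \<le> psum \<delta> m" if "m \<le> length \<gamma>" "m \<le> length \<delta>" for m
    using maj that by (simp add: majorizes_def psum_def)
  show "\<forall>m. psum \<gamma> m \<le> psum \<delta> m"
  proof (intro allI)
    fix m
    have "length \<delta> \<le> length \<gamma>"
    proof (rule ccontr)
      assume "\<not> length \<delta> \<le> length \<gamma>"
      then have "psum \<gamma> (length \<gamma>) = n" "psum \<delta> (length \<gamma>) < n"
        using assms by (auto simp: Dis_psum_eq_iff Dis_psum_less_iff)
      then show False
        using le[of "length \<gamma>"] \<open>\<not> length \<delta> \<le> length \<gamma>\<close> by simp
    qed
    then show "psum \<gamma> m \<le> psum \<delta> m"
      using le[of m] Dis_psum_eq_iff[OF assms(2), of m] Dis_psum_le[OF assms(1), of m]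
      by (cases "m \<le> length \<delta>") auto
  qed
qed (simp add: majorizes_def psum_def)

lemma Dis_eqI:
  assumes "\<gamma> \<in> Dis n" "\<delta> \<in> Dis n" "\<And>m. psum \<gamma> m = psum \<delta> m"
  shows "\<gamma> = \<delta>"
proof (rule nth_equalityI)
  show len: "length \<gamma> = length \<delta>"
    by (metis assms Dis_psum_eq_iff le_antisym order_refl)
  show "\<gamma> ! i = \<delta> ! i" if "i < length \<gamma>" for i
    using psum_Suc[of i \<gamma>] psum_Suc[of i \<delta>] that len assms(3)[of i] assms(3)[of "Suc i"] by simp
qed

lemma majorizes_trans:
  assumes "\<gamma> \<succeq> \<delta>" "\<delta> \<succeq> \<epsilon>" "\<gamma> \<in> Dis n" "\<delta> \<in> Dis n" "\<epsilon> \<in> Dis n"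
  shows "\<gamma> \<succeq> \<epsilon>"
  using assms by (auto simp: majorizes_iff_psum intro: le_trans)

lemma majorizes_antisym:
  assumes "\<gamma> \<succeq> \<delta>" "\<delta> \<succeq> \<gamma>" "\<gamma> \<in> Dis n" "\<delta> \<in> Dis n"
  shows "\<gamma> = \<delta>"
  using assms by (auto simp: majorizes_iff_psum intro!: Dis_eqI le_antisym)

section \<open>Meets and joins of partitions\<close>

text \<open>
  Strict concavity of the partial sums says that the parts strictly decrease, so that elements of
  \<open>Dis n\<close> can be constructed by giving their partial sums.
\<close>

lemma Dis_of_concave:
  fixes p :: "nat \<Rightarrow> nat"
  assumes "p 0 = 0" "p k = n"
    and inc: "\<And>m. m < k \<Longrightarrow> p m < p (Suc m)"
    and conc: "\<And>m. Suc m < k \<Longrightarrow> p m + p (Suc (Suc m)) < 2 * p (Suc m)"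
  obtains \<gamma> where "\<gamma> \<in> Dis n" "length \<gamma> = k" "\<And>m. m \<le> k \<Longrightarrow> psum \<gamma> m = p m"
proof
  define \<gamma> where "\<gamma> = map (\<lambda>m. p (Suc m) - p m) [0..<k]"
  show len: "length \<gamma> = k"
    by (simp add: \<gamma>_def)
  show psum: "psum \<gamma> m = p m" if "m \<le> k" for m
    using that
  proof (induction m)
    case (Suc m)
    then have "psum \<gamma> (Suc m) = p m + (p (Suc m) - p m)"
      by (simp add: psum_Suc len) (simp add: \<gamma>_def)
    then show ?case
      using inc[of m] Suc.prems by simp
  qed (simp add: assms)
  have "sum_list \<gamma> = n"
    using psum[of k] psum_beyond[of \<gamma> k] len assms(2) by simp
  moreover have "\<forall>g\<in>set \<gamma>. g > 0"
    using inc by (auto simp: \<gamma>_def)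
  moreover have "sorted_wrt (>) \<gamma>"
  proof -
    have "\<gamma> ! Suc m < \<gamma> ! m" if "Suc m < k" for m
      using conc[OF that] inc[of m] inc[of "Suc m"] that by (simp add: \<gamma>_def)
    then show ?thesis
      by (subst sorted_wrt_iff_nth_Suc_transp) (auto simp: len transp_def)
  qed
  ultimately show "\<gamma> \<in> Dis n"
    by (simp add: Dis_def)
qed

text \<open>
  Strict concavity survives pointwise minima of integer sequences: at the index in question the
  minimum is attained by one member of the family, whose second difference is negative there, and at
  the two neighbouring indices the minimum is at most this member. The member that attains the
  minimum at an index \<open>m\<close> with value below \<open>n\<close> has more than \<open>m\<close> parts, which is where its strict
  concavity is available.
\<close>

lemma Dis_Inf:
  assumes "S \<subseteq> Dis n" "S \<noteq> {}"
  obtains \<gamma> where "\<gamma> \<in> Dis n" "\<And>m. psum \<gamma> m = (INF \<delta>\<in>S. psum \<delta> m)"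
proof -
  define p where "p m = (INF \<delta>\<in>S. psum \<delta> m)" for m
  have attained: "\<exists>\<delta>\<in>S. p m = psum \<delta> m" for m
  proof -
    have "p m \<in> (\<lambda>\<delta>. psum \<delta> m) ` S"
      unfolding p_def using assms(2) by (intro Inf_nat_def1) simp
    then show ?thesis by auto
  qed
  have lower: "p m \<le> psum \<delta> m" if "\<delta> \<in> S" for \<delta> m
    unfolding p_def using that by (intro cInf_lower) auto
  obtain \<delta>\<^sub>0 where "\<delta>\<^sub>0 \<in> S"
    using assms(2) by auto
  have p_le: "p m \<le> n" for m
    using lower[OF \<open>\<delta>\<^sub>0 \<in> S\<close>, of m] Dis_psum_le[of \<delta>\<^sub>0 n m] \<open>\<delta>\<^sub>0 \<in> S\<close> assms(1) by fastforce
  have p_mono: "p m \<le> p m'" if "m \<le> m'" for m m'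
  proof -
    obtain \<delta> where "\<delta> \<in> S" "p m' = psum \<delta> m'"
      using attained by blast
    then show ?thesis
      using lower[of \<delta> m] psum_mono[OF that, of \<delta>] by simp
  qed
  have ex: "\<exists>m. p m = n"
  proof -
    have "\<exists>m. psum \<delta>\<^sub>0 m = n"
      using Dis_psum_eq_iff[of \<delta>\<^sub>0 n] \<open>\<delta>\<^sub>0 \<in> S\<close> assms(1) by blast
    show ?thesis
    proof (rule ccontr)
      assume neg: "\<nexists>m. p m = n"
      have "m \<le> p m" for m
      proof (induction m)
        case (Suc m)
        obtain \<delta> where \<delta>: "\<delta> \<in> S" "p (Suc m) = psum \<delta> (Suc m)"
          using attained by blast
        with neg have "psum \<delta> (Suc m) < n"
          using p_le[of "Suc m"] by (metis le_neq_implies_less)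
        then have "Suc m < length \<delta>" "\<delta> \<in> Dis n"
          using \<delta> assms(1) Dis_psum_less_iff by blast+
        then have "psum \<delta> m < psum \<delta> (Suc m)"
          by (auto simp: psum_Suc Dis_def)
        then show ?case
          using Suc lower[OF \<delta>(1), of m] \<delta>(2) by simp
      qed simp
      from this[of "Suc n"] show False
        using p_le[of "Suc n"] by simp
    qed
  qed
  define k where "k = (LEAST m. p m = n)"
  have pk: "p k = n"
    unfolding k_def using ex by (rule LeastI_ex)
  have below: "p m < n" if "m < k" for m
    using not_less_Least[of m "\<lambda>m. p m = n"] that p_le[of m] by (simp add: k_def less_le)
  have inc: "p m < p (Suc m)" if "m < k" for m
  proof -
    obtain \<delta> where \<delta>: "\<delta> \<in> S" "p (Suc m) = psum \<delta> (Suc m)"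
      using attained by blast
    then have D: "\<delta> \<in> Dis n"
      using assms(1) by auto
    show ?thesis
    proof (cases "m < length \<delta>")
      case True
      then have "psum \<delta> m < psum \<delta> (Suc m)"
        using D by (auto simp: psum_Suc Dis_def)
      then show ?thesis
        using lower[OF \<delta>(1), of m] \<delta>(2) by simp
    next
      case False
      then have "psum \<delta> (Suc m) = n"
        using D by (simp add: Dis_psum_eq_iff)
      then show ?thesis
        using below[OF that] \<delta>(2) by simp
    qed
  qed
  have conc: "p m + p (Suc (Suc m)) < 2 * p (Suc m)" if "Suc m < k" for m
  proof -
    obtain \<delta> where \<delta>: "\<delta> \<in> S" "p (Suc m) = psum \<delta> (Suc m)"
      using attained by blast
    then have D: "\<delta> \<in> Dis n"
      using assms(1) by auto
    have len: "Suc m < length \<delta>"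
      using below[OF that] \<delta>(2) Dis_psum_less_iff[OF D] by simp
    then have "\<delta> ! Suc m < \<delta> ! m"
      using D sorted_wrt_nth_less[of "(>)" \<delta> m "Suc m"] by (simp add: Dis_def)
    then have "psum \<delta> m + psum \<delta> (Suc (Suc m)) < 2 * psum \<delta> (Suc m)"
      using len by (simp add: psum_Suc)
    then show ?thesis
      using lower[OF \<delta>(1), of m] lower[OF \<delta>(1), of "Suc (Suc m)"] \<delta>(2) by linarith
  qed
  have "p 0 = 0"
    using attained[of 0] by auto
  from Dis_of_concave[OF this pk inc conc]
  obtain \<gamma> where \<gamma>: "\<gamma> \<in> Dis n" "length \<gamma> = k" "\<And>m. m \<le> k \<Longrightarrow> psum \<gamma> m = p m"
    by metis
  have "psum \<gamma> m = p m" for m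
  proof (cases "m \<le> k")
    case False
    then have "psum \<gamma> m = n" "p m = n"
      using \<gamma> Dis_psum_eq_iff[OF \<gamma>(1), of m] p_mono[of k m] pk p_le[of m] by auto
    then show ?thesis by simp
  qed (use \<gamma> in auto)
  then show thesis
    using that[of \<gamma>] \<gamma>(1) by (simp add: p_def)
qed

lemma partial_order_Dis: "partial_order (Dis_order n)"
proof
  fix x y assume "x .=\<^bsub>Dis_order n\<^esub> y" then show "y .=\<^bsub>Dis_order n\<^esub> x"
    by (simp add: Dis_order_def)
next
  fix x y
  assume "x \<sqsubseteq>\<^bsub>Dis_order n\<^esub> y" "y \<sqsubseteq>\<^bsub>Dis_order n\<^esub> x"
    "x \<in> carrier (Dis_order n)" "y \<in> carrier (Dis_order n)"
  then show "x .=\<^bsub>Dis_order n\<^esub> y"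
    by (auto simp: Dis_order_def intro: majorizes_antisym)
qed (auto simp: Dis_order_def majorizes_iff_psum intro: le_trans)

lemma partial_order_S_Block: "partial_order (S_Block_order n)"
proof
  fix x y
  assume xy: "x \<sqsubseteq>\<^bsub>S_Block_order n\<^esub> y" "y \<sqsubseteq>\<^bsub>S_Block_order n\<^esub> x"
    "x \<in> carrier (S_Block_order n)" "y \<in> carrier (S_Block_order n)"
  from xy show "x .=\<^bsub>S_Block_order n\<^esub> y"
    by (cases x; cases y) (auto simp: S_Block_order_def S_Block_def intro: majorizes_antisym)
next
  fix x y z
  assume xyz: "x \<sqsubseteq>\<^bsub>S_Block_order n\<^esub> y" "y \<sqsubseteq>\<^bsub>S_Block_order n\<^esub> z"
    "x \<in> carrier (S_Block_order n)" "y \<in> carrier (S_Block_order n)" "z \<in> carrier (S_Block_order n)"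
  from xyz show "x \<sqsubseteq>\<^bsub>S_Block_order n\<^esub> z"
    by (cases x; cases y; cases z) (auto simp: S_Block_order_def S_Block_def intro: majorizes_trans)
next
  fix x assume "x \<in> carrier (S_Block_order n)"
  then show "x \<sqsubseteq>\<^bsub>S_Block_order n\<^esub> x"
    by (cases x) (auto simp: S_Block_order_def S_Block_def majorizes_iff_psum)
qed (auto simp: S_Block_order_def)

text \<open>
  Joins and meets are defined by Hilbert choice, which antisymmetry makes unique.
\<close>

lemma join_eqI:
  assumes "partial_order L" "least L s (Upper L {x, y})"
  shows "x \<squnion>\<^bsub>L\<^esub> y = s"
  unfolding join_def sup_def
  using assms partial_order.least_unique by (metis (no_types, lifting) someI)

lemma meet_eqI:
  assumes "partial_order L" "greatest L s (Lower L {x, y})"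
  shows "x \<sqinter>\<^bsub>L\<^esub> y = s"
  unfolding meet_def inf_def
  using assms partial_order.greatest_unique by (metis (no_types, lifting) someI)

lemma Dis_meet:
  assumes "\<gamma> \<in> Dis n" "\<delta> \<in> Dis n"
  defines "\<mu> \<equiv> \<gamma> \<sqinter>\<^bsub>Dis_order n\<^esub> \<delta>"
  shows "\<mu> \<in> Dis n" "psum \<mu> m = min (psum \<gamma> m) (psum \<delta> m)"
proof -
  obtain \<epsilon> where \<epsilon>: "\<epsilon> \<in> Dis n" "\<And>m. psum \<epsilon> m = (INF \<zeta>\<in>{\<gamma>, \<delta>}. psum \<zeta> m)"
    using Dis_Inf[of "{\<gamma>, \<delta>}" n] assms by blast
  then have min: "psum \<epsilon> m = min (psum \<gamma> m) (psum \<delta> m)" for m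
    by (simp add: cInf_eq_Min)
  have "greatest (Dis_order n) \<epsilon> (Lower (Dis_order n) {\<gamma>, \<delta>})"
    using assms(1,2) \<epsilon>(1) min
    by (auto simp: greatest_def Lower_def Dis_order_def majorizes_iff_psum)
  then have "\<mu> = \<epsilon>"
    unfolding \<mu>_def by (intro meet_eqI partial_order_Dis)
  then show "\<mu> \<in> Dis n" "psum \<mu> m = min (psum \<gamma> m) (psum \<delta> m)"
    using \<epsilon>(1) min by auto
qed

text \<open>
  The join is the infimum of all common upper bounds, and \<open>[n]\<close> is one of these. Unlike the meet, it
  is not computed pointwise, and only its universal property is used below.
\<close>

lemma Dis_join:
  assumes "n > 0" "\<gamma> \<in> Dis n" "\<delta> \<in> Dis n"
  defines "\<sigma> \<equiv> \<gamma> \<squnion>\<^bsub>Dis_order n\<^esub> \<delta>"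
  shows "\<sigma> \<in> Dis n" "\<sigma> \<succeq> \<gamma>" "\<sigma> \<succeq> \<delta>"
    "\<And>\<epsilon>. \<epsilon> \<in> Dis n \<Longrightarrow> \<epsilon> \<succeq> \<gamma> \<Longrightarrow> \<epsilon> \<succeq> \<delta> \<Longrightarrow> \<epsilon> \<succeq> \<sigma>"
proof -
  let ?S = "{\<epsilon> \<in> Dis n. \<epsilon> \<succeq> \<gamma> \<and> \<epsilon> \<succeq> \<delta>}"
  have "[n] \<in> Dis n"
    using assms(1) by (simp add: Dis_def)
  moreover have "psum \<zeta> m \<le> psum [n] m" if "\<zeta> \<in> Dis n" for \<zeta> m
    using that Dis_psum_le[OF that, of m] by (cases m) (auto simp: psum_def)
  ultimately have "[n] \<in> ?S"
    using assms by (simp add: majorizes_iff_psum)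
  then obtain \<epsilon> where \<epsilon>: "\<epsilon> \<in> Dis n" "\<And>m. psum \<epsilon> m = (INF \<zeta>\<in>?S. psum \<zeta> m)"
    using Dis_Inf[of ?S n] by blast
  have "psum \<gamma> m \<le> psum \<epsilon> m" "psum \<delta> m \<le> psum \<epsilon> m" for m
    unfolding \<epsilon>(2) using \<open>[n] \<in> ?S\<close> assms
    by (auto intro!: cINF_greatest simp: majorizes_iff_psum)
  then have ub: "\<epsilon> \<succeq> \<gamma>" "\<epsilon> \<succeq> \<delta>"
    using assms \<epsilon>(1) by (auto simp: majorizes_iff_psum)
  have lub: "\<zeta> \<succeq> \<epsilon>" if "\<zeta> \<in> ?S" for \<zeta>
    using that \<epsilon> by (auto simp: majorizes_iff_psum intro!: cINF_lower)
  have "least (Dis_order n) \<epsilon> (Upper (Dis_order n) {\<gamma>, \<delta>})"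
    using assms(2,3) \<epsilon>(1) ub lub by (auto simp: least_def Upper_def Dis_order_def)
  then have "\<sigma> = \<epsilon>"
    unfolding \<sigma>_def by (intro join_eqI partial_order_Dis)
  then show "\<sigma> \<in> Dis n" "\<sigma> \<succeq> \<gamma>" "\<sigma> \<succeq> \<delta>"
    "\<And>\<epsilon>. \<epsilon> \<in> Dis n \<Longrightarrow> \<epsilon> \<succeq> \<gamma> \<Longrightarrow> \<epsilon> \<succeq> \<delta> \<Longrightarrow> \<epsilon> \<succeq> \<sigma>"
    using \<epsilon>(1) ub lub by auto
qed

section \<open>Smallest parts\<close>

lemma Dis_k_iff_psum:
  assumes "\<gamma> \<in> Dis n" "k > 0"
  shows "\<gamma> \<in> Dis_k k n \<longleftrightarrow> psum \<gamma> k = n \<and> psum \<gamma> (k - 1) < n"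
  using assms by (auto simp: Dis_k_def Dis_psum_eq_iff Dis_psum_less_iff)

lemma psum_last:
  assumes "\<gamma> \<in> Dis_k k n" "k > 0"
  shows "psum \<gamma> (k - 1) + last \<gamma> = n"
proof -
  have "psum \<gamma> (Suc (k - 1)) = psum \<gamma> (k - 1) + \<gamma> ! (k - 1)"
    using assms by (intro psum_Suc) (auto simp: Dis_k_def)
  moreover have "last \<gamma> = \<gamma> ! (k - 1)"
    using assms by (auto simp: Dis_k_def last_conv_nth)
  moreover have "psum \<gamma> k = n"
    using assms by (simp add: Dis_k_def Dis_psum_eq_iff)
  ultimately show ?thesis
    using assms(2) by simp
qed

lemma last_antimono:
  assumes "\<gamma> \<in> Dis_k k n" "\<delta> \<in> Dis_k k n" "k > 0" "\<delta> \<succeq> \<gamma>"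
  shows "last \<delta> \<le> last \<gamma>"
proof -
  have "psum \<gamma> (k - 1) \<le> psum \<delta> (k - 1)"
    using assms by (auto simp: Dis_k_def majorizes_iff_psum)
  then show ?thesis
    using psum_last[of \<gamma> k n] psum_last[of \<delta> k n] assms by simp
qed

lemma Dis_k_meet:
  assumes "\<gamma> \<in> Dis_k k n" "\<delta> \<in> Dis_k k n" "k > 0"
  defines "\<mu> \<equiv> \<gamma> \<sqinter>\<^bsub>Dis_order n\<^esub> \<delta>"
  shows "\<mu> \<in> Dis_k k n" "last \<mu> = max (last \<gamma>) (last \<delta>)"
proof -
  have D: "\<gamma> \<in> Dis n" "\<delta> \<in> Dis n"
    using assms by (auto simp: Dis_k_def)
  note \<mu> = Dis_meet[OF D, folded \<mu>_def]
  show *: "\<mu> \<in> Dis_k k n"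
    using assms(1-3) D \<mu> by (auto simp: Dis_k_iff_psum)
  show "last \<mu> = max (last \<gamma>) (last \<delta>)"
    using psum_last[OF *] psum_last[OF assms(1)] psum_last[OF assms(2)] assms(3) \<mu>(2)[of "k - 1"]
    by linarith
qed

text \<open>
  The second conjunct, a bound on the largest part, is what the induction for the sum needs; it is
  also used on its own.
\<close>

lemma staircase_le_sum_list:
  fixes \<gamma> :: "nat list"
  assumes "sorted_wrt (>) \<gamma>" "\<forall>g\<in>set \<gamma>. t \<le> g"
  shows "sum_list [t..<t + length \<gamma>] \<le> sum_list \<gamma> \<and> (\<gamma> \<noteq> [] \<longrightarrow> t + length \<gamma> \<le> Suc (hd \<gamma>))"
  using assms
proof (induction \<gamma>)
  case (Cons g \<gamma>)
  then show ?case
    by (cases \<gamma>) auto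
qed simp

text \<open>
  If there are partitions of \<open>n\<close> into \<open>k\<close> distinct parts of size at least \<open>t\<close>, this is the largest of
  them: all parts except the first are as small as possible.
\<close>

definition top_partition :: "nat \<Rightarrow> nat \<Rightarrow> nat \<Rightarrow> nat list" where
  "top_partition t k n = (n - sum_list [t..<t + (k - 1)]) # rev [t..<t + (k - 1)]"

lemma last_le_of_mem:
  assumes "sorted_wrt (>) (\<gamma> :: nat list)" "g \<in> set \<gamma>"
  shows "last \<gamma> \<le> g"
  using assms by (induction \<gamma>) (auto simp: less_imp_le)

lemma top_partition:
  assumes "\<gamma> \<in> Dis_k k n" "k > 0" "0 < t" "t \<le> last \<gamma>"
  shows "top_partition t k n \<in> Dis_k k n" "top_partition t k n \<succeq> \<gamma>"
    "t \<le> last (top_partition t k n)"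
proof -
  let ?\<tau> = "top_partition t k n"
  have \<gamma>: "sorted_wrt (>) \<gamma>" "sum_list \<gamma> = n" "length \<gamma> = k"
    and D: "\<gamma> \<in> Dis n"
    using assms by (auto simp: Dis_k_def Dis_def)
  have ge: "\<forall>g\<in>set \<gamma>. t \<le> g"
    using last_le_of_mem[OF \<gamma>(1)] assms(4) le_trans by blast
  have tail: "sum_list [t..<t + (k - m)] \<le> sum_list (drop m \<gamma>)" for m
    using staircase_le_sum_list[of "drop m \<gamma>" t] \<gamma> ge
    by (auto simp: sorted_wrt_drop dest: in_set_dropD)
  have total: "sum_list [t..<t + k] \<le> n"
    using tail[of 0] \<gamma> by simp
  moreover have "[t..<t + k] = [t..<t + (k - 1)] @ [t + (k - 1)]"
    using assms(2) by (cases k) auto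
  ultimately have first: "sum_list [t..<t + (k - 1)] + (t + (k - 1)) \<le> n"
    by simp
  have "sorted_wrt (>) (rev [t..<t + (k - 1)])"
    by (simp add: sorted_wrt_rev)
  then show T: "?\<tau> \<in> Dis_k k n"
    using first assms(2,3) by (auto simp: Dis_k_def Dis_def top_partition_def)
  then have TD: "?\<tau> \<in> Dis n" "length ?\<tau> = k"
    by (auto simp: Dis_k_def)
  have "psum \<gamma> m \<le> psum ?\<tau> m" for m
  proof (cases "m = 0 \<or> k \<le> m")
    case False
    have "drop m ?\<tau> = rev [t..<t + (k - m)]"
      using False by (cases m) (auto simp: top_partition_def drop_rev)
    moreover have "psum \<zeta> m + sum_list (drop m \<zeta>) = sum_list \<zeta>" for \<zeta>
      by (metis append_take_drop_id psum_def sum_list_append)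
    from this[of ?\<tau>] this[of \<gamma>]
    have "psum ?\<tau> m + sum_list (drop m ?\<tau>) = psum \<gamma> m + sum_list (drop m \<gamma>)"
      using \<gamma>(2) TD(1) by (simp add: Dis_def)
    ultimately have "psum ?\<tau> m + sum_list [t..<t + (k - m)] = psum \<gamma> m + sum_list (drop m \<gamma>)"
      by (simp add: sum_list_rev del: sum_list_upt)
    then show ?thesis
      using tail[of m] by linarith
  next
    case True
    then show ?thesis
    proof
      assume "k \<le> m"
      then show ?thesis
        using Dis_psum_eq_iff[OF TD(1), of m] Dis_psum_le[OF D, of m] TD(2) by simp
    qed simp
  qed
  then show "?\<tau> \<succeq> \<gamma>"
    using TD D by (simp add: majorizes_iff_psum)
  show "t \<le> last ?\<tau>"
    using first by (auto simp: top_partition_def last_rev hd_append)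
qed

text \<open>
  The join majorizes both partitions, so it has at most \<open>k\<close> parts, the last one at most the minimum
  \<open>t\<close> of the two smallest parts. It is majorized by \<open>top_partition t k n\<close>, so it has at
  least \<open>k\<close> parts, the last one at least \<open>t\<close>.
\<close>

lemma Dis_k_join:
  assumes "n > 0" "\<gamma> \<in> Dis_k k n" "\<delta> \<in> Dis_k k n" "k > 0"
  defines "\<sigma> \<equiv> \<gamma> \<squnion>\<^bsub>Dis_order n\<^esub> \<delta>"
  shows "\<sigma> \<in> Dis_k k n" "last \<sigma> = min (last \<gamma>) (last \<delta>)"
proof -
  have D: "\<gamma> \<in> Dis n" "\<delta> \<in> Dis n"
    using assms by (auto simp: Dis_k_def)
  note \<sigma> = Dis_join[OF assms(1) D, folded \<sigma>_def]
  define t where "t = min (last \<gamma>) (last \<delta>)"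
  have "last \<zeta> > 0" if "\<zeta> \<in> Dis_k k n" for \<zeta>
    using that assms(4) by (auto simp: Dis_k_def Dis_def)
  then have t: "0 < t" "t \<le> last \<gamma>" "t \<le> last \<delta>"
    using assms(2,3) by (auto simp: t_def)
  let ?\<tau> = "top_partition t k n"
  have T: "?\<tau> \<in> Dis_k k n" "?\<tau> \<succeq> \<sigma>"
    using top_partition[OF assms(2) assms(4) t(1,2)] top_partition[OF assms(3) assms(4) t(1,3)]
      \<sigma>(4)[of ?\<tau>] by (auto simp: Dis_k_def)
  have "psum \<gamma> k \<le> psum \<sigma> k" "psum \<sigma> (k - 1) \<le> psum ?\<tau> (k - 1)"
    using \<sigma> D T by (auto simp: majorizes_iff_psum Dis_k_def)
  moreover have "psum \<gamma> k = n"
    using Dis_k_iff_psum[OF D(1) assms(4)] assms(2) by simp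
  moreover have "psum ?\<tau> (k - 1) < n"
    using Dis_k_iff_psum[of ?\<tau> n k] assms(4) T(1) by (simp add: Dis_k_def)
  ultimately show *: "\<sigma> \<in> Dis_k k n"
    using Dis_k_iff_psum[OF \<sigma>(1) assms(4)] Dis_psum_le[OF \<sigma>(1), of k] by linarith
  show "last \<sigma> = min (last \<gamma>) (last \<delta>)"
    using last_antimono[OF _ * assms(4) \<sigma>(2)] last_antimono[OF _ * assms(4) \<sigma>(3)]
      last_antimono[OF * T(1) assms(4) T(2)] assms(2,3)
      top_partition(3)[OF assms(2) assms(4) t(1,2)]
    by (simp add: t_def)
qed

section \<open>Meets and joins of blocks\<close>

text \<open>
  The pair is always a block, because \<open>\<beta>\<^sub>1 \<squnion> \<beta>\<^sub>2 \<succeq> \<beta>\<^sub>1 \<succeq> \<alpha>\<^sub>1 \<succeq> \<alpha>\<^sub>1 \<sqinter> \<alpha>\<^sub>2\<close>.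
\<close>

lemma block_meet:
  assumes "n > 0" "k > 0" "(\<alpha>\<^sub>1, \<beta>\<^sub>1) \<in> A_block n k" "(\<alpha>\<^sub>2, \<beta>\<^sub>2) \<in> A_block n k"
  defines "b \<equiv> (\<alpha>\<^sub>1 \<sqinter>\<^bsub>Dis_order n\<^esub> \<alpha>\<^sub>2, \<beta>\<^sub>1 \<squnion>\<^bsub>Dis_order n\<^esub> \<beta>\<^sub>2)"
  shows "b \<in> A_block n k"
    "Elem (\<alpha>\<^sub>1, \<beta>\<^sub>1) \<sqinter>\<^bsub>S_Block_order n\<^esub> Elem (\<alpha>\<^sub>2, \<beta>\<^sub>2) = Elem b"
proof -
  have k: "\<alpha>\<^sub>1 \<in> Dis_k k n" "\<alpha>\<^sub>2 \<in> Dis_k k n" "\<beta>\<^sub>1 \<in> Dis_k k n" "\<beta>\<^sub>2 \<in> Dis_k k n"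
    and maj: "\<beta>\<^sub>1 \<succeq> \<alpha>\<^sub>1" "\<beta>\<^sub>2 \<succeq> \<alpha>\<^sub>2"
    and S: "(\<alpha>\<^sub>1, \<beta>\<^sub>1) \<in> S_Block n" "(\<alpha>\<^sub>2, \<beta>\<^sub>2) \<in> S_Block n"
    using assms by (auto simp: A_block_def S_Block_def)
  then have D: "\<alpha>\<^sub>1 \<in> Dis n" "\<alpha>\<^sub>2 \<in> Dis n" "\<beta>\<^sub>1 \<in> Dis n" "\<beta>\<^sub>2 \<in> Dis n"
    by (auto simp: Dis_k_def)
  obtain \<alpha> \<beta> where b: "b = (\<alpha>, \<beta>)" "\<alpha> = \<alpha>\<^sub>1 \<sqinter>\<^bsub>Dis_order n\<^esub> \<alpha>\<^sub>2" "\<beta> = \<beta>\<^sub>1 \<squnion>\<^bsub>Dis_order n\<^esub> \<beta>\<^sub>2"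
    by (simp add: b_def)
  have bk: "\<alpha> \<in> Dis_k k n" "\<beta> \<in> Dis_k k n"
    using Dis_k_meet(1) Dis_k_join(1) k assms(1,2) b by auto
  then have bD: "\<alpha> \<in> Dis n" "\<beta> \<in> Dis n"
    by (auto simp: Dis_k_def)
  have a: "psum \<alpha> m = min (psum \<alpha>\<^sub>1 m) (psum \<alpha>\<^sub>2 m)" for m
    using Dis_meet(2)[OF D(1,2)] b by simp
  note join = Dis_join(2-4)[OF assms(1) D(3,4), folded b(3)]
  have "\<beta> \<succeq> \<alpha>"
    using join(1) maj(1) D bD a by (auto simp: majorizes_iff_psum intro: min.coboundedI1 order_trans)
  then show A: "b \<in> A_block n k"
    using bk bD b by (auto simp: A_block_def S_Block_def Dis_k_def)
  have aL: "\<alpha>\<^sub>1 \<succeq> \<alpha>" "\<alpha>\<^sub>2 \<succeq> \<alpha>" "\<And>\<epsilon>. \<epsilon> \<in> Dis n \<Longrightarrow> \<alpha>\<^sub>1 \<succeq> \<epsilon> \<Longrightarrow> \<alpha>\<^sub>2 \<succeq> \<epsilon> \<Longrightarrow> \<alpha> \<succeq> \<epsilon>"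
    using D bD a by (auto simp: majorizes_iff_psum)
  have "hatted_le block_le y (Elem (\<alpha>, \<beta>))"
    if "y \<in> Elem ` S_Block n \<union> {Hat0, Hat1}" "hatted_le block_le y (Elem (\<alpha>\<^sub>1, \<beta>\<^sub>1))"
      "hatted_le block_le y (Elem (\<alpha>\<^sub>2, \<beta>\<^sub>2))" for y
    using that aL join by (cases y) (auto simp: S_Block_def)
  then have "greatest (S_Block_order n) (Elem b) (Lower (S_Block_order n) {Elem (\<alpha>\<^sub>1, \<beta>\<^sub>1), Elem (\<alpha>\<^sub>2, \<beta>\<^sub>2)})"
    using A S aL join b(1)
    by (auto simp: greatest_def Lower_def S_Block_order_def A_block_def)
  then show "Elem (\<alpha>\<^sub>1, \<beta>\<^sub>1) \<sqinter>\<^bsub>S_Block_order n\<^esub> Elem (\<alpha>\<^sub>2, \<beta>\<^sub>2) = Elem b"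
    by (intro meet_eqI partial_order_S_Block)
qed

text \<open>
  A block \<open>[\<gamma>|\<delta>]\<close> above both blocks satisfies \<open>\<beta> \<succeq> \<delta> \<succeq> \<gamma> \<succeq> \<alpha>\<close>. Hence if \<open>\<beta> \<succeq> \<alpha>\<close> fails, there is no
  common upper bound other than the new maximum.
\<close>

lemma block_join:
  assumes "n > 0" "k > 0" "(\<alpha>\<^sub>1, \<beta>\<^sub>1) \<in> A_block n k" "(\<alpha>\<^sub>2, \<beta>\<^sub>2) \<in> A_block n k"
  defines "\<alpha> \<equiv> \<alpha>\<^sub>1 \<squnion>\<^bsub>Dis_order n\<^esub> \<alpha>\<^sub>2" and "\<beta> \<equiv> \<beta>\<^sub>1 \<sqinter>\<^bsub>Dis_order n\<^esub> \<beta>\<^sub>2"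
  shows "\<beta> \<succeq> \<alpha> \<Longrightarrow> (\<alpha>, \<beta>) \<in> A_block n k"
    "Elem (\<alpha>\<^sub>1, \<beta>\<^sub>1) \<squnion>\<^bsub>S_Block_order n\<^esub> Elem (\<alpha>\<^sub>2, \<beta>\<^sub>2) = (if \<beta> \<succeq> \<alpha> then Elem (\<alpha>, \<beta>) else Hat1)"
proof -
  have k: "\<alpha>\<^sub>1 \<in> Dis_k k n" "\<alpha>\<^sub>2 \<in> Dis_k k n" "\<beta>\<^sub>1 \<in> Dis_k k n" "\<beta>\<^sub>2 \<in> Dis_k k n"
    and S: "(\<alpha>\<^sub>1, \<beta>\<^sub>1) \<in> S_Block n" "(\<alpha>\<^sub>2, \<beta>\<^sub>2) \<in> S_Block n"
    using assms by (auto simp: A_block_def S_Block_def)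
  then have D: "\<alpha>\<^sub>1 \<in> Dis n" "\<alpha>\<^sub>2 \<in> Dis n" "\<beta>\<^sub>1 \<in> Dis n" "\<beta>\<^sub>2 \<in> Dis n"
    by (auto simp: Dis_k_def)
  have bk: "\<alpha> \<in> Dis_k k n" "\<beta> \<in> Dis_k k n"
    using Dis_k_meet(1) Dis_k_join(1) k assms(1,2) by (auto simp: \<alpha>_def \<beta>_def)
  then have bD: "\<alpha> \<in> Dis n" "\<beta> \<in> Dis n"
    by (auto simp: Dis_k_def)
  show A: "(\<alpha>, \<beta>) \<in> A_block n k" if "\<beta> \<succeq> \<alpha>"
    using that bk bD by (auto simp: A_block_def S_Block_def Dis_k_def)
  have b: "psum \<beta> m = min (psum \<beta>\<^sub>1 m) (psum \<beta>\<^sub>2 m)" for m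
    using Dis_meet(2)[OF D(3,4)] by (simp add: \<beta>_def)
  note join = Dis_join(2-4)[OF assms(1) D(1,2), folded \<alpha>_def]
  have bL: "\<beta>\<^sub>1 \<succeq> \<beta>" "\<beta>\<^sub>2 \<succeq> \<beta>" "\<And>\<epsilon>. \<epsilon> \<in> Dis n \<Longrightarrow> \<beta>\<^sub>1 \<succeq> \<epsilon> \<Longrightarrow> \<beta>\<^sub>2 \<succeq> \<epsilon> \<Longrightarrow> \<beta> \<succeq> \<epsilon>"
    using D bD b by (auto simp: majorizes_iff_psum)
  let ?J = "if \<beta> \<succeq> \<alpha> then Elem (\<alpha>, \<beta>) else Hat1"
  have "hatted_le block_le ?J y"
    if "y \<in> Elem ` S_Block n \<union> {Hat0, Hat1}" "hatted_le block_le (Elem (\<alpha>\<^sub>1, \<beta>\<^sub>1)) y"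
      "hatted_le block_le (Elem (\<alpha>\<^sub>2, \<beta>\<^sub>2)) y" for y
  proof (cases y)
    case (Elem c)
    obtain \<gamma> \<delta> where c: "c = (\<gamma>, \<delta>)" by (cases c)
    with Elem that have cD: "\<gamma> \<in> Dis n" "\<delta> \<in> Dis n" "\<delta> \<succeq> \<gamma>"
      by (auto simp: S_Block_def)
    have "\<gamma> \<succeq> \<alpha>" "\<beta> \<succeq> \<delta>"
      using that c Elem cD join(3) bL(3) by auto
    moreover from this have "\<beta> \<succeq> \<alpha>"
      using majorizes_trans cD bD by meson
    ultimately show ?thesis
      by (simp add: Elem c)
  qed (use that in auto)
  then have "least (S_Block_order n) ?J (Upper (S_Block_order n) {Elem (\<alpha>\<^sub>1, \<beta>\<^sub>1), Elem (\<alpha>\<^sub>2, \<beta>\<^sub>2)})"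
    using A S bL join
    by (auto simp: least_def Upper_def S_Block_order_def A_block_def)
  then show "Elem (\<alpha>\<^sub>1, \<beta>\<^sub>1) \<squnion>\<^bsub>S_Block_order n\<^esub> Elem (\<alpha>\<^sub>2, \<beta>\<^sub>2) = ?J"
    by (intro join_eqI partial_order_S_Block)
qed

section \<open>Greedy colouring and chromatic numbers of NG-graphs\<close>

lemma not_edge_self: "simple_graph V E \<Longrightarrow> {v, v} \<notin> E"
  by (auto simp: simple_graph_def)

lemma edge_subset: "simple_graph V E \<Longrightarrow> {u, v} \<in> E \<Longrightarrow> u \<in> V \<and> v \<in> V"
  by (auto simp: simple_graph_def)

lemma degree_eq_card_neighbours:
  assumes "simple_graph V E"
  shows "degree E v = card {u. {u, v} \<in> E}"
proof -
  have "bij_betw (\<lambda>u. {u, v}) {u. {u, v} \<in> E} {e \<in> E. v \<in> e}"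
  proof (rule bij_betw_imageI)
    show "inj_on (\<lambda>u. {u, v}) {u. {u, v} \<in> E}"
      by (auto simp: inj_on_def doubleton_eq_iff)
    have "\<exists>u. e = {u, v}" if "e \<in> E" "v \<in> e" for e
    proof -
      have "card e = 2"
        using assms that by (auto simp: simple_graph_def)
      then show ?thesis
        using that(2) by (auto simp: card_2_iff)
    qed
    then show "(\<lambda>u. {u, v}) ` {u. {u, v} \<in> E} = {e \<in> E. v \<in> e}"
      by fastforce
  qed
  then show ?thesis
    by (simp add: degree_def bij_betw_same_card)
qed

lemma finite_neighbours: "simple_graph V E \<Longrightarrow> finite {u. {u, v} \<in> E}"
  by (rule finite_subset[of _ V]) (auto simp: simple_graph_def)

lemma simple_graph_complement: "simple_graph V E \<Longrightarrow> simple_graph V (complement_edges V E)"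
  by (auto simp: simple_graph_def complement_edges_def)

lemma edge_complement_iff:
  "{u, v} \<in> complement_edges V E \<longleftrightarrow> u \<in> V \<and> v \<in> V \<and> u \<noteq> v \<and> {u, v} \<notin> E"
  by (auto simp: complement_edges_def card_2_iff doubleton_eq_iff)

lemma degree_complement:
  assumes G: "simple_graph V E" and "v \<in> V"
  shows "degree (complement_edges V E) v + degree E v + 1 = card V"
proof -
  let ?N = "{u. {u, v} \<in> E}" and ?N' = "{u. {u, v} \<in> complement_edges V E}"
  have "V = insert v (?N' \<union> ?N)"
    using assms edge_subset[OF G] by (auto simp: edge_complement_iff)
  moreover have "?N' \<inter> ?N = {}" "v \<notin> ?N' \<union> ?N"
    using not_edge_self[OF G] by (auto simp: edge_complement_iff)
  ultimately have "card V = Suc (card ?N' + card ?N)"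
    using finite_neighbours[OF G] finite_neighbours[OF simple_graph_complement[OF G]]
    by (metis card_Un_disjoint card_insert_disjoint finite_UnI)
  then show ?thesis
    by (simp add: degree_eq_card_neighbours[OF G]
        degree_eq_card_neighbours[OF simple_graph_complement[OF G]])
qed

lemma chromatic_number_le: "proper_coloring V E m c \<Longrightarrow> chromatic_number V E \<le> m"
  unfolding chromatic_number_def by (rule Least_le) blast

text \<open>
  The vertices outside \<open>S\<close> are coloured one at a time; a vertex of degree less than \<open>m\<close> always finds
  one of the \<open>m\<close> colours absent from its neighbours.
\<close>

lemma greedy_coloring_extension:
  assumes G: "simple_graph V E" and "S \<subseteq> V" and c: "proper_coloring S E m c"
    and deg: "\<And>v. v \<in> V - S \<Longrightarrow> degree E v < m"
  shows "\<exists>c. proper_coloring V E m c"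
proof -
  have "\<exists>c. proper_coloring (S \<union> T) E m c" if "finite T" "T \<subseteq> V - S" for T
    using that
  proof (induction T rule: finite_induct)
    case (insert v T)
    then obtain c where c: "proper_coloring (S \<union> T) E m c"
      by auto
    let ?N = "{u. {u, v} \<in> E}"
    have "card (c ` ?N) \<le> degree E v"
      unfolding degree_eq_card_neighbours[OF G] by (intro card_image_le finite_neighbours[OF G])
    also have "\<dots> < card {..<m}"
      using deg[of v] insert.prems by simp
    finally obtain x where x: "x < m" "x \<notin> c ` ?N"
      using card_mono[of "c ` ?N" "{..<m}"] finite_neighbours[OF G] by fastforce
    have "v \<notin> S \<union> T"
      using insert by auto
    then have "proper_coloring (S \<union> insert v T) E m (c(v := x))"
    proof -
      have "c u \<noteq> x" if "{u, v} \<in> E \<or> {v, u} \<in> E" for u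
        using x(2) that insert_commute[of v u "{}"] by auto
      then show ?thesis
        using c x(1) not_edge_self[OF G] unfolding proper_coloring_def by auto
    qed
    then show ?case
      by blast
  qed (use c in auto)
  from this[of "V - S"] show ?thesis
    using G \<open>S \<subseteq> V\<close> by (simp add: simple_graph_def Un_absorb1)
qed

text \<open>
  The vertices of \<open>C\<close> get distinct colours, the stable set \<open>A\<close> shares one further colour, and the
  remaining vertices are coloured greedily. The upper bounds on chromatic numbers of NG-graphs come from
  this lemma, applied to the graph or to its complement.
\<close>

lemma chromatic_number_le_greedy:
  assumes G: "simple_graph V E" and "C \<subseteq> V" "A \<subseteq> V" "stable_set E A"
    and m: "card C + of_bool (A \<noteq> {}) \<le> m"
    and deg: "\<And>v. v \<in> V \<Longrightarrow> v \<notin> C \<Longrightarrow> v \<notin> A \<Longrightarrow> degree E v < m"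
  shows "chromatic_number V E \<le> m"
proof -
  have "finite C"
    using G \<open>C \<subseteq> V\<close> by (auto simp: simple_graph_def intro: finite_subset)
  then obtain f where f: "bij_betw f C {0..<card C}"
    using ex_bij_betw_finite_nat by blast
  then have inj: "inj_on f C" and lt: "\<And>v. v \<in> C \<Longrightarrow> f v < card C"
    by (auto simp: bij_betw_def)
  have "proper_coloring (C \<union> A) E m (\<lambda>v. if v \<in> C then f v else card C)"
    unfolding proper_coloring_def
  proof (intro conjI ballI impI)
    fix v assume v: "v \<in> C \<union> A"
    then show "(if v \<in> C then f v else card C) < m"
      using m lt[of v] by (cases "v \<in> C") (auto simp: of_bool_def split: if_splits)
  next
    fix u v assume "u \<in> C \<union> A" "v \<in> C \<union> A" "{u, v} \<in> E"
    then have "u \<noteq> v" "u \<in> C \<or> v \<in> C"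
      using not_edge_self[OF G] \<open>stable_set E A\<close> unfolding stable_set_def by blast+
    then show "(if u \<in> C then f u else card C) \<noteq> (if v \<in> C then f v else card C)"
      using inj_onD[OF inj, of u v] lt[of u] lt[of v] by auto
  qed
  then have "\<exists>c. proper_coloring V E m c"
    by (rule greedy_coloring_extension[OF G, rotated]) (use assms in auto)
  then show ?thesis
    using chromatic_number_le by blast
qed

lemma card_degree_split:
  assumes "finite V"
  shows "card V = card {v \<in> V. degree E v < k} + card {v \<in> V. k \<le> degree E v}"
  using assms by (subst card_Un_disjoint[symmetric]) (auto intro!: arg_cong[of _ _ card])

text \<open>
  The degree conditions on \<open>k\<close> say that the sorted degree sequence has \<open>d\<^sub>k\<^sub>+\<^sub>1 = k\<close>, counting from 1.
  Greedy colouring from the vertices of degree above \<open>k\<close>, and in the complement from those of degree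
  below \<open>k\<close>, gives upper bounds with sum \<open>|V| + 1\<close>. In an NG-graph both bounds are therefore attained,
  so that \<open>A_set\<close> consists of the vertices of degree \<open>k\<close>.
\<close>

lemma NG_chromatic_numbers:
  assumes NG: "NG_graph V E"
    and high: "card {v \<in> V. k < degree E v} \<le> k" "k < card {v \<in> V. k \<le> degree E v}"
  shows "chromatic_number V E = k + 1"
    "chromatic_number V (complement_edges V E) = card V - k"
proof -
  have G: "simple_graph V E" and fin: "finite V"
    and sum: "chromatic_number V E + chromatic_number V (complement_edges V E) = card V + 1"
    using NG by (auto simp: NG_graph_def simple_graph_def)
  have "chromatic_number V E \<le> k + 1"
    using high by (intro chromatic_number_le_greedy[OF G, of "{v \<in> V. k < degree E v}" "{}"])
      (auto simp: stable_set_def)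
  moreover note card_degree_split[OF fin, of E k]
  moreover have "chromatic_number V (complement_edges V E) \<le> card V - k"
  proof (intro chromatic_number_le_greedy[OF simple_graph_complement[OF G],
        of "{v \<in> V. degree E v < k}" "{}"])
    fix v assume "v \<in> V" "v \<notin> {v \<in> V. degree E v < k}"
    then show "degree (complement_edges V E) v < card V - k"
      using degree_complement[OF G, of v] by simp
  qed (use high calculation in \<open>auto simp: stable_set_def\<close>)
  ultimately show "chromatic_number V E = k + 1"
    "chromatic_number V (complement_edges V E) = card V - k"
    using sum high(2) by linarith+
qed

text \<open>
  If the vertices of degree \<open>k\<close> form a clique, they can share a colour in the complement. With more than
  \<open>k + 1\<close> vertices of degree at least \<open>k\<close>, this saves a colour compared with the chromatic number of
  the complement.
\<close>

lemma NG1_graph_card_high_degree: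
  assumes NG1: "NG1_graph V E"
    and high: "card {v \<in> V. k < degree E v} \<le> k" "k < card {v \<in> V. k \<le> degree E v}"
  shows "card {v \<in> V. k \<le> degree E v} = k + 1"
proof (rule ccontr)
  assume "card {v \<in> V. k \<le> degree E v} \<noteq> k + 1"
  with high have large: "k + 2 \<le> card {v \<in> V. k \<le> degree E v}"
    by simp
  have NG: "NG_graph V E" and G: "simple_graph V E" and fin: "finite V"
    using NG1 by (auto simp: NG1_graph_def NG_graph_def simple_graph_def)
  note \<chi> = NG_chromatic_numbers[OF NG high]
  define A where "A = {v \<in> V. degree E v = k}"
  have "clique E A"
    using NG1 \<chi>(1) by (simp add: NG1_graph_def A_set_def A_def)
  then have "stable_set (complement_edges V E) A"
    by (auto simp: clique_def stable_set_def edge_complement_iff)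
  note V = card_degree_split[OF fin, of E k]
  have "chromatic_number V (complement_edges V E) \<le> card V - k - 1"
  proof (rule chromatic_number_le_greedy[OF simple_graph_complement[OF G] _ _
        \<open>stable_set (complement_edges V E) A\<close>])
    show "card {v \<in> V. degree E v < k} + of_bool (A \<noteq> {}) \<le> card V - k - 1"
    proof -
      have "card {v \<in> V. degree E v < k} + 1 \<le> card V - k - 1"
        using V large by linarith
      then show ?thesis
        by (simp add: of_bool_def)
    qed
    fix v assume "v \<in> V" "v \<notin> {v \<in> V. degree E v < k}" "v \<notin> A"
    then show "degree (complement_edges V E) v < card V - k - 1"
      using degree_complement[OF G, of v] V large by (simp add: A_def)
  qed (auto simp: A_def)
  then show False
    using \<chi>(2) V large by simp
qed

text \<open>
  If the vertices of degree \<open>k\<close> form a stable set, they can share a colour. With fewer than \<open>k\<close>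
  vertices of larger degree, this colours the graph with only \<open>k\<close> colours.
\<close>

lemma NG2_graph_card_high_degree:
  assumes NG2: "NG2_graph V E"
    and high: "card {v \<in> V. k < degree E v} \<le> k" "k < card {v \<in> V. k \<le> degree E v}"
  shows "card {v \<in> V. k < degree E v} = k"
proof (rule ccontr)
  assume "card {v \<in> V. k < degree E v} \<noteq> k"
  with high have small: "card {v \<in> V. k < degree E v} < k"
    by simp
  have NG: "NG_graph V E" and G: "simple_graph V E"
    using NG2 by (auto simp: NG2_graph_def NG_graph_def)
  note \<chi> = NG_chromatic_numbers[OF NG high]
  define A where "A = {v \<in> V. degree E v = k}"
  have "stable_set E A"
    using NG2 \<chi>(1) by (simp add: NG2_graph_def A_set_def A_def)
  then have "chromatic_number V E \<le> k"
    using small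
    by (intro chromatic_number_le_greedy[OF G, of "{v \<in> V. k < degree E v}" A])
      (auto simp: of_bool_def A_def)
  then show False
    using \<chi>(1) by simp
qed

section \<open>The smallest parts of a block of a degree sequence\<close>

lemma mset_degree_sequence:
  "mset (degree_sequence V E) = image_mset (degree E) (mset_set V)"
  by (simp add: degree_sequence_def)

lemma sorted_degree_sequence: "sorted_wrt (\<ge>) (degree_sequence V E)"
  by (simp add: degree_sequence_def sorted_wrt_rev)

lemma conj_part_degree_sequence:
  assumes "finite V"
  shows "conj_part (degree_sequence V E) j = card {v \<in> V. j \<le> degree E v}"
proof -
  have "conj_part (degree_sequence V E) j
      = size (filter_mset ((\<le>) j) (mset (degree_sequence V E)))"
    by (simp add: conj_part_def length_filter_conv_card flip: mset_filter)
  then show ?thesis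
    using assms by (simp add: mset_degree_sequence filter_mset_image_mset filter_mset_mset_set)
qed

lemma conj_part_antimono: "j \<le> j' \<Longrightarrow> conj_part \<pi> j' \<le> conj_part \<pi> j"
  by (auto simp: conj_part_def intro!: card_mono)

lemma conj_part_le_length: "conj_part \<pi> j \<le> length \<pi>"
  using card_mono[of "{..<length \<pi>}" "{i. i < length \<pi> \<and> j \<le> \<pi> ! i}"]
  by (auto simp: conj_part_def)

lemma less_card_downset_iff:
  assumes "\<And>i i'. i \<le> i' \<Longrightarrow> i' < l \<Longrightarrow> P i' \<Longrightarrow> P i" "i < l"
  shows "i < card {i. i < l \<and> P i} \<longleftrightarrow> P i"
proof
  assume "P i"
  then have "{..i} \<subseteq> {i. i < l \<and> P i}"
    using assms by auto
  then show "i < card {i. i < l \<and> P i}"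
    using card_mono[of "{i. i < l \<and> P i}" "{..i}"] by simp
next
  assume *: "i < card {i. i < l \<and> P i}"
  show "P i"
  proof (rule ccontr)
    assume "\<not> P i"
    then have "{i. i < l \<and> P i} \<subseteq> {..<i}"
      using assms by (auto simp: not_less[symmetric])
    then show False
      using * card_mono[of "{..<i}" "{i. i < l \<and> P i}"] by simp
  qed
qed

lemma less_conj_part_iff:
  assumes "sorted_wrt (\<ge>) \<pi>" "i < length \<pi>"
  shows "i < conj_part \<pi> j \<longleftrightarrow> j \<le> \<pi> ! i"
  unfolding conj_part_def
proof (rule less_card_downset_iff)
  fix i i' assume "i \<le> i'" "i' < length \<pi>" "j \<le> \<pi> ! i'"
  then show "j \<le> \<pi> ! i"
    using sorted_wrt_nth_less[OF assms(1), of i i'] by (cases "i = i'") auto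
qed (rule assms(2))

lemma filter_upt_downset:
  assumes "\<And>i j. a \<le> i \<Longrightarrow> i \<le> j \<Longrightarrow> P j \<Longrightarrow> P i"
  shows "filter P [a..<b] = [a..<a + length (filter P [a..<b])]"
proof (induction b)
  case (Suc b)
  show ?case
  proof (cases "a \<le> b \<and> P b")
    case True
    then have "filter P [a..<b] = [a..<b]"
      using assms[of _ b] by (auto simp: filter_id_conv)
    with True show ?thesis
      by simp
  qed (use Suc in auto)
qed simp

text \<open>
  The indices that contribute parts to \<open>alpha_of \<pi>\<close> and to \<open>beta_of \<pi>\<close> form initial segments. The first
  segment ends at the largest \<open>k\<close> with \<open>d\<^sub>k \<ge> k\<close> and the second at the largest \<open>k\<close> with
  \<open>d\<^sub>k\<^sub>+\<^sub>1 \<ge> k\<close>; that both have length \<open>k\<close> amounts to \<open>d\<^sub>k\<^sub>+\<^sub>1 = k\<close>. The smallest part of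
  \<open>beta_of \<pi>\<close> then is the number of entries of size at least \<open>k\<close>, minus \<open>k\<close>, and that of \<open>alpha_of \<pi>\<close>
  tells by how much \<open>d\<^sub>k\<close> exceeds \<open>k - 1\<close>.
\<close>

lemma alpha_beta_of_equal_lengths:
  assumes sorted: "sorted_wrt (\<ge>) \<pi>" and "k > 0"
    and len: "length (alpha_of \<pi>) = k" "length (beta_of \<pi>) = k"
  shows "conj_part \<pi> (Suc k) \<le> k" "k < conj_part \<pi> k"
    "last (beta_of \<pi>) = conj_part \<pi> k - k"
    "conj_part \<pi> (Suc k) = k \<Longrightarrow> last (alpha_of \<pi>) \<ge> 2"
proof -
  let ?a = "filter (\<lambda>i. i < \<pi> ! i) [0..<length \<pi>]"
  let ?b = "filter (\<lambda>j. j < conj_part \<pi> j) [1..<length \<pi> + 1]"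
  have a_iff: "i < \<pi> ! i \<longleftrightarrow> i < conj_part \<pi> (Suc i)" if "i < length \<pi>" for i
    using less_conj_part_iff[OF sorted that, of "Suc i"] by auto
  have "?a = filter (\<lambda>i. i < conj_part \<pi> (Suc i)) [0..<length \<pi>]"
    by (intro filter_cong) (auto simp: a_iff)
  moreover have "i < conj_part \<pi> (Suc i)" if "i \<le> j" "j < conj_part \<pi> (Suc j)" for i j
    using that conj_part_antimono[of "Suc i" "Suc j" \<pi>] by simp
  ultimately have a: "?a = [0..<k]"
    using filter_upt_downset[of 0 "\<lambda>i. i < conj_part \<pi> (Suc i)" "length \<pi>"] len(1)
    by (simp add: alpha_of_def)
  have "i < conj_part \<pi> i" if "i \<le> j" "j < conj_part \<pi> j" for i j
    using that conj_part_antimono[of i j \<pi>] by simp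
  then have "?b = [1..<1 + length ?b]"
    by (intro filter_upt_downset) blast
  moreover have "length ?b = k"
    using len(2) unfolding beta_of_def length_map .
  ultimately have b: "?b = [1..<1 + k]"
    by (simp only:)
  show "k < conj_part \<pi> k"
  proof -
    have "k \<in> set ?b"
      unfolding b using \<open>k > 0\<close> by simp
    then show ?thesis
      by simp
  qed
  then have k: "k < length \<pi>"
    using conj_part_le_length[of \<pi> k] by simp
  show "conj_part \<pi> (Suc k) \<le> k"
  proof -
    have "k \<notin> set ?a"
      unfolding a by simp
    then show ?thesis
      using k a_iff[OF k] by auto
  qed
  show "last (beta_of \<pi>) = conj_part \<pi> k - k"
    unfolding beta_of_def b using \<open>k > 0\<close> by (simp add: last_map)
  show "last (alpha_of \<pi>) \<ge> 2" if "conj_part \<pi> (Suc k) = k"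
  proof -
    have "last (alpha_of \<pi>) = \<pi> ! (k - 1) - (k - 1)"
      unfolding alpha_of_def a using \<open>k > 0\<close> by (simp add: last_map)
    moreover have "Suc k \<le> \<pi> ! (k - 1)"
      using less_conj_part_iff[OF sorted, of "k - 1" "Suc k"] k that \<open>k > 0\<close> by simp
    ultimately show ?thesis
      using \<open>k > 0\<close> by linarith
  qed
qed

lemma NG1_block_last:
  assumes "(\<alpha>, \<beta>) \<in> A_block n k" "k > 0" "NG1_block (\<alpha>, \<beta>)"
  shows "last \<beta> = 1"
proof -
  obtain V :: "nat set" and E where NG1: "NG1_graph V E"
    and \<alpha>: "\<alpha> = alpha_of (degree_sequence V E)" and \<beta>: "\<beta> = beta_of (degree_sequence V E)"
    using assms(3) by (auto simp: NG1_block_def)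
  have fin: "finite V"
    using NG1 by (simp add: NG1_graph_def NG_graph_def simple_graph_def)
  have "length \<alpha> = k" "length \<beta> = k"
    using assms(1) by (auto simp: A_block_def Dis_k_def)
  note * = alpha_beta_of_equal_lengths[OF sorted_degree_sequence assms(2)
      this[unfolded \<alpha> \<beta>], unfolded conj_part_degree_sequence[OF fin] Suc_le_eq]
  show ?thesis
    using NG1_graph_card_high_degree[OF NG1 *(1,2)] *(3) \<beta> by simp
qed

lemma NG2_block_last:
  assumes "(\<alpha>, \<beta>) \<in> A_block n k" "k > 0" "NG2_block (\<alpha>, \<beta>)"
  shows "last \<alpha> \<ge> 2"
proof -
  obtain V :: "nat set" and E where NG2: "NG2_graph V E"
    and \<alpha>: "\<alpha> = alpha_of (degree_sequence V E)" and \<beta>: "\<beta> = beta_of (degree_sequence V E)"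
    using assms(3) by (auto simp: NG2_block_def)
  have fin: "finite V"
    using NG2 by (simp add: NG2_graph_def NG_graph_def simple_graph_def)
  have "length \<alpha> = k" "length \<beta> = k"
    using assms(1) by (auto simp: A_block_def Dis_k_def)
  note * = alpha_beta_of_equal_lengths[OF sorted_degree_sequence assms(2)
      this[unfolded \<alpha> \<beta>], unfolded conj_part_degree_sequence[OF fin] Suc_le_eq]
  show ?thesis
    using NG2_graph_card_high_degree[OF NG2 *(1,2)] *(4) \<alpha> by simp
qed

section \<open>Bipartite graphs with prescribed degrees\<close>

text \<open>
  A \<open>0\<close>-\<open>1\<close> matrix is given by the sets \<open>R i\<close> of columns with entry \<open>1\<close> in row \<open>i\<close>. Let \<open>p\<close> be the first
  row of wrong size, which is too large by dominance, and \<open>q\<close> the first row that is too small. As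
  \<open>a\<close> decreases, row \<open>p\<close> is larger than row \<open>q\<close> and has an entry in a column where row \<open>q\<close> has none. Moving
  this entry from \<open>p\<close> to \<open>q\<close> keeps all column sums. It also keeps dominance, because only the partial
  sums between \<open>p\<close> and \<open>q\<close> drop, and only by one, while these exceed those of \<open>a\<close>.
\<close>

lemma rows_of_given_size:
  fixes R :: "nat \<Rightarrow> 'b set" and a :: "nat \<Rightarrow> nat"
  assumes anti: "\<And>i j. i \<le> j \<Longrightarrow> j < k \<Longrightarrow> a j \<le> a i"
    and "\<And>i. i < k \<Longrightarrow> finite (R i)"
    and "\<And>m. m \<le> k \<Longrightarrow> sum a {..<m} \<le> (\<Sum>i<m. card (R i))"
    and "sum a {..<k} = (\<Sum>i<k. card (R i))"
  shows "\<exists>R'. (\<forall>i<k. finite (R' i) \<and> card (R' i) = a i) \<and>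
    (\<forall>j. card {i. i < k \<and> j \<in> R' i} = card {i. i < k \<and> j \<in> R i})"
  using assms(2-)
proof (induction "\<Sum>i<k. card (R i) - a i" arbitrary: R rule: less_induct)
  case less
  note fin = less.prems(1) and dom = less.prems(2) and total = less.prems(3)
  show ?case
  proof (cases "\<forall>i<k. card (R i) = a i")
    case True
    then show ?thesis
      using fin by auto
  next
    case False
    define p where "p = (LEAST i. i < k \<and> card (R i) \<noteq> a i)"
    have p: "p < k" "card (R p) \<noteq> a p"
      using LeastI_ex[of "\<lambda>i. i < k \<and> card (R i) \<noteq> a i"] False by (auto simp: p_def)
    have before_p: "card (R i) = a i" if "i < p" for i
      using not_less_Least[of i "\<lambda>i. i < k \<and> card (R i) \<noteq> a i"] that p(1) by (auto simp: p_def)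
    have ap: "a p < card (R p)"
    proof -
      have "sum a {..<p} = (\<Sum>i<p. card (R i))"
        by (intro sum.cong) (auto simp: before_p)
      then show ?thesis
        using dom[of "Suc p"] p by simp
    qed
    have "\<exists>q<k. card (R q) < a q"
    proof (rule ccontr)
      assume "\<not> (\<exists>q<k. card (R q) < a q)"
      then have "a i \<le> card (R i)" if "i < k" for i
        using that by (meson not_less)
      then have "sum a {..<k} < (\<Sum>i<k. card (R i))"
        using p(1) ap by (intro sum_strict_mono_ex1) auto
      then show False
        using total by simp
    qed
    define q where "q = (LEAST i. i < k \<and> card (R i) < a i)"
    have q: "q < k" "card (R q) < a q"
      using LeastI_ex[of "\<lambda>i. i < k \<and> card (R i) < a i"] \<open>\<exists>q<k. card (R q) < a q\<close>
      by (auto simp: q_def)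
    have before_q: "a i \<le> card (R i)" if "i < q" for i
      using not_less_Least[of i "\<lambda>i. i < k \<and> card (R i) < a i"] that q(1) by (auto simp: q_def)
    have pq: "p < q"
      using before_p[of q] q(2) ap by (cases p q rule: linorder_cases) auto
    have "card (R q) < card (R p)"
      using q(2) ap anti[of p q] pq q(1) by linarith
    then obtain c where c: "c \<in> R p" "c \<notin> R q"
      using card_mono[OF fin[OF q(1)], of "R p"] by fastforce
    define R' where "R' = R(p := R p - {c}, q := insert c (R q))"
    have cardR': "card (R' i) = (if i = p then card (R p) - 1
        else if i = q then card (R q) + 1 else card (R i))" for i
      using c pq fin p(1) q(1) by (simp add: R'_def)
    have sumR': "(\<Sum>i<m. card (R' i)) + of_bool (p < m) = (\<Sum>i<m. card (R i)) + of_bool (q < m)"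
      for m
    proof (induction m)
      case (Suc m)
      show ?case
        using Suc pq ap by (auto simp: cardR' of_bool_def less_Suc_eq split: if_splits)
    qed simp
    have "\<exists>R''. (\<forall>i<k. finite (R'' i) \<and> card (R'' i) = a i) \<and>
      (\<forall>j. card {i. i < k \<and> j \<in> R'' i} = card {i. i < k \<and> j \<in> R' i})"
    proof (rule less.hyps)
      show "(\<Sum>i<k. card (R' i) - a i) < (\<Sum>i<k. card (R i) - a i)"
        using p(1) q pq ap by (intro sum_strict_mono_ex1) (auto simp: cardR')
      show "finite (R' i)" if "i < k" for i
        using fin that p(1) q(1) by (simp add: R'_def)
      show "sum a {..<k} = (\<Sum>i<k. card (R' i))"
        using sumR'[of k] p(1) q(1) total by simp
      show "sum a {..<m} \<le> (\<Sum>i<m. card (R' i))" if "m \<le> k" for m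
      proof (cases "p < m \<and> m \<le> q")
        case True
        then have "sum a {..<m} < (\<Sum>i<m. card (R i))"
          using before_q ap by (intro sum_strict_mono_ex1) auto
        then show ?thesis
          using sumR'[of m] True by simp
      next
        case False
        then show ?thesis
          using sumR'[of m] dom[OF that] pq by (auto simp: of_bool_def split: if_splits)
      qed
    qed
    moreover have "card {i. i < k \<and> j \<in> R' i} = card {i. i < k \<and> j \<in> R i}" for j
    proof (cases "j = c")
      case True
      have "{i. i < k \<and> c \<in> R' i} = insert q ({i. i < k \<and> c \<in> R i} - {p})"
        using pq q(1) by (auto simp: R'_def)
      moreover have "card (insert q ({i. i < k \<and> c \<in> R i} - {p}))
          = Suc (card ({i. i < k \<and> c \<in> R i} - {p}))"
        using c by (intro card_insert_disjoint) auto
      moreover have "\<dots> = card {i. i < k \<and> c \<in> R i}"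
        using c p(1) by (intro card_Suc_Diff1) auto
      ultimately show ?thesis
        using True by simp
    next
      case False
      then show ?thesis
        by (auto simp: R'_def intro!: arg_cong[of _ _ card])
    qed
    ultimately show ?thesis
      by simp
  qed
qed

text \<open>
  The sufficiency half of the Gale-Ryser theorem. The Young diagram with rows \<open>b i\<close> has the required
  column sums and serves as the start of the moves.
\<close>

lemma Gale_Ryser:
  fixes a b :: "nat \<Rightarrow> nat"
  assumes "\<And>i j. i \<le> j \<Longrightarrow> j < k \<Longrightarrow> a j \<le> a i"
    and "\<And>m. m \<le> k \<Longrightarrow> sum a {..<m} \<le> sum b {..<m}"
    and "sum a {..<k} = sum b {..<k}"
  obtains R :: "nat \<Rightarrow> nat set"
  where "\<And>i. i < k \<Longrightarrow> finite (R i)" "\<And>i. i < k \<Longrightarrow> card (R i) = a i"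
    "\<And>j. card {i. i < k \<and> j \<in> R i} = card {i. i < k \<and> j < b i}"
proof -
  have "\<exists>R. (\<forall>i<k. finite (R i) \<and> card (R i) = a i) \<and>
    (\<forall>j. card {i. i < k \<and> j \<in> R i} = card {i. i < k \<and> j \<in> {..<b i}})"
    by (rule rows_of_given_size) (use assms in auto)
  then show thesis
    using that by auto
qed

section \<open>Realizing blocks by split graphs\<close>

lemma degree_sequence_lessThan:
  assumes "sorted_wrt (\<ge>) (map (degree E) [0..<N])"
  shows "degree_sequence {..<N} E = map (degree E) [0..<N]"
proof -
  let ?ds = "map (degree E) [0..<N]"
  have ds: "image_mset (degree E) (mset_set {..<N}) = mset ?ds"
    by (simp add: lessThan_atLeast0)
  moreover have "sort ?ds = rev ?ds"
    using assms by (intro properties_for_sort) (simp_all add: sorted_wrt_rev)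
  ultimately show ?thesis
    by (simp only: degree_sequence_def ds sorted_list_of_multiset_mset rev_rev_ident)
qed

text \<open>
  The split graph whose clique is \<open>{..<k}\<close>, in which the clique vertex \<open>i\<close> is joined to the vertices
  \<open>k + j\<close> of the stable set with \<open>j \<in> R i\<close>.
\<close>

definition split_edges :: "nat \<Rightarrow> (nat \<Rightarrow> nat set) \<Rightarrow> nat set set" where
  "split_edges k R = {{i, v} | i v. i < v \<and> i < k \<and> (v < k \<or> v - k \<in> R i)}"

lemma split_edges_iff:
  assumes "i < v"
  shows "{i, v} \<in> split_edges k R \<longleftrightarrow> i < k \<and> (v < k \<or> v - k \<in> R i)"
  using assms by (auto simp: split_edges_def doubleton_eq_iff)

lemma split_edges_clique: "i < k \<Longrightarrow> i' < k \<Longrightarrow> i \<noteq> i' \<Longrightarrow> {i, i'} \<in> split_edges k R"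
  using split_edges_iff[of i i'] split_edges_iff[of i' i]
  by (cases i i' rule: linorder_cases) (auto simp: insert_commute)

lemma split_edges_cross:
  assumes "i < k"
  shows "{i, k + j} \<in> split_edges k R \<longleftrightarrow> j \<in> R i" "{k + j, i} \<in> split_edges k R \<longleftrightarrow> j \<in> R i"
  using split_edges_iff[of i "k + j" k R] assms by (auto simp: insert_commute)

lemma split_edges_stable: "k \<le> u \<Longrightarrow> k \<le> v \<Longrightarrow> {u, v} \<notin> split_edges k R"
  by (auto simp: split_edges_def doubleton_eq_iff)

lemma simple_graph_split:
  assumes "\<And>i. i < k \<Longrightarrow> R i \<subseteq> {..<s}"
  shows "simple_graph {..<k + s} (split_edges k R)"
  using assms by (fastforce simp: simple_graph_def split_edges_def)

lemma degree_split_clique: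
  assumes R: "\<And>i. i < k \<Longrightarrow> R i \<subseteq> {..<s}" and "i < k"
  shows "degree (split_edges k R) i = k - 1 + card (R i)"
proof -
  let ?E = "split_edges k R"
  have "u = i \<or> u < k \<or> (\<exists>j\<in>R i. u = k + j)" if "{u, i} \<in> ?E" for u
  proof (cases "u < k")
    case False
    then have "u = k + (u - k)"
      by simp
    then show ?thesis
      using that split_edges_cross(2)[OF \<open>i < k\<close>, of "u - k" R] by metis
  qed simp
  moreover have "{i, i} \<notin> ?E"
    by (auto simp: split_edges_def doubleton_eq_iff)
  ultimately have "{u. {u, i} \<in> ?E} = ({..<k} - {i}) \<union> (+) k ` R i"
    using split_edges_clique[of _ k i R] split_edges_cross(2)[OF \<open>i < k\<close>, of _ R] \<open>i < k\<close>
    by auto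
  moreover have "finite (R i)"
    using R[OF \<open>i < k\<close>] finite_subset by blast
  ultimately show ?thesis
    using \<open>i < k\<close>
    by (simp add: degree_eq_card_neighbours[OF simple_graph_split[OF R]])
      (subst card_Un_disjoint, auto simp: card_image)
qed

lemma degree_split_stable:
  assumes R: "\<And>i. i < k \<Longrightarrow> R i \<subseteq> {..<s}"
  shows "degree (split_edges k R) (k + j) = card {i. i < k \<and> j \<in> R i}"
proof -
  have "{u. {u, k + j} \<in> split_edges k R} = {i. i < k \<and> j \<in> R i}"
    using split_edges_cross(1)[of _ k j R] split_edges_stable[of k _ "k + j" R]
    by (auto simp: not_less[symmetric])
  then show ?thesis
    by (simp add: degree_eq_card_neighbours[OF simple_graph_split[OF R]])
qed

lemma clique_split:
  assumes full: "\<And>i. i < k \<Longrightarrow> 0 \<in> R i"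
  shows "clique (split_edges k R) {..k}"
  unfolding clique_def
proof (intro ballI impI)
  fix u v assume "u \<in> {..k}" "v \<in> {..k}" "u \<noteq> v"
  then show "{u, v} \<in> split_edges k R"
    using split_edges_clique[of u k v R] split_edges_cross[of u k 0 R]
      split_edges_cross[of v k 0 R] full
    by (cases "u = k"; cases "v = k") auto
qed

lemma chromatic_number_exact:
  assumes "clique E C" "C \<subseteq> V" "finite C" and c: "proper_coloring V E (card C) c"
  shows "chromatic_number V E = card C"
proof (rule antisym)
  show "chromatic_number V E \<le> card C"
    by (rule chromatic_number_le[OF c])
  have "\<exists>c. proper_coloring V E (chromatic_number V E) c"
    unfolding chromatic_number_def by (rule LeastI_ex) (use c in blast)
  then obtain c' where c': "proper_coloring V E (chromatic_number V E) c'"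
    by blast
  have "inj_on c' C"
  proof (rule inj_onI, rule ccontr)
    fix u v assume "u \<in> C" "v \<in> C" "c' u = c' v" "u \<noteq> v"
    then have "{u, v} \<in> E" "u \<in> V" "v \<in> V"
      using assms(1,2) by (auto simp: clique_def)
    then show False
      using c' \<open>c' u = c' v\<close> unfolding proper_coloring_def by blast
  qed
  moreover have "c' ` C \<subseteq> {..<chromatic_number V E}"
    using assms(2) c' by (auto simp: proper_coloring_def)
  ultimately show "card C \<le> chromatic_number V E"
    using card_inj_on_le[of c' C "{..<chromatic_number V E}"] by simp
qed

text \<open>
  The vertex \<open>k\<close>, adjacent to all of \<open>{..<k}\<close>, makes the clique one larger; the other vertices of the
  stable set share its colour. In the complement the roles are reversed: \<open>{..<k}\<close> is stable and can
  share the colour of \<open>k\<close>, to which it is nowhere adjacent there. The chromatic numbers add up to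
  \<open>|V| + 1\<close>, as they must in an NG-graph.
\<close>

lemma chromatic_numbers_split:
  assumes R: "\<And>i. i < k \<Longrightarrow> R i \<subseteq> {..<s}"
    and full: "\<And>i. i < k \<Longrightarrow> 0 \<in> R i" and "0 < s"
  shows "chromatic_number {..<k + s} (split_edges k R) = k + 1"
    "chromatic_number {..<k + s} (complement_edges {..<k + s} (split_edges k R)) = s"
proof -
  let ?V = "{..<k + s}" and ?E = "split_edges k R"
  have G: "simple_graph ?V ?E"
    by (rule simple_graph_split) (rule R)
  have cl: "clique ?E {..k}"
    by (rule clique_split) (rule full)
  have "proper_coloring ?V ?E (card {..k}) (\<lambda>v. min v k)"
    unfolding proper_coloring_def
  proof (intro conjI ballI impI)
    fix u v assume "{u, v} \<in> ?E"
    then have "u \<noteq> v" "\<not> (k \<le> u \<and> k \<le> v)"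
      using split_edges_stable[of k u v R] not_edge_self[OF G, of u] by auto
    then show "min u k \<noteq> min v k"
      by linarith
  qed simp
  moreover have "{..k} \<subseteq> ?V"
    using \<open>0 < s\<close> by auto
  ultimately show "chromatic_number ?V ?E = k + 1"
    using chromatic_number_exact[OF cl _ finite_atMost] by simp
  let ?E' = "complement_edges ?V ?E"
  have "clique ?E' {k..<k + s}"
    using split_edges_stable[of k _ _ R] by (auto simp: clique_def edge_complement_iff)
  \<comment> \<open>Truncated subtraction gives the colour \<open>0\<close> of the vertex \<open>k\<close> to all smaller vertices.\<close>
  moreover have "proper_coloring ?V ?E' (card {k..<k + s}) (\<lambda>v. v - k)"
    unfolding proper_coloring_def
  proof (intro conjI ballI impI)
    fix v assume "v \<in> ?V"
    then show "v - k < card {k..<k + s}"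
      using \<open>0 < s\<close> by auto
  next
    fix u v assume uv: "u \<in> ?V" "v \<in> ?V" "{u, v} \<in> ?E'"
    then have "u \<noteq> v" "{u, v} \<notin> ?E"
      by (auto simp: edge_complement_iff)
    moreover have "u \<notin> {..k} \<or> v \<notin> {..k}"
      using cl \<open>u \<noteq> v\<close> \<open>{u, v} \<notin> ?E\<close> unfolding clique_def by blast
    ultimately show "u - k \<noteq> v - k"
      by auto
  qed
  moreover have "{k..<k + s} \<subseteq> ?V"
    by auto
  ultimately show "chromatic_number ?V ?E' = s"
    using chromatic_number_exact[of ?E' "{k..<k + s}" ?V] by simp
qed

lemma Dis_k_nth_bounds:
  assumes "\<gamma> \<in> Dis_k k n"
  shows "i < j \<Longrightarrow> j < k \<Longrightarrow> \<gamma> ! j < \<gamma> ! i" "i < k \<Longrightarrow> k \<le> \<gamma> ! i + i"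
proof -
  have \<gamma>: "sorted_wrt (>) \<gamma>" "length \<gamma> = k" and pos: "\<forall>g\<in>set \<gamma>. 1 \<le> g"
    using assms by (auto simp: Dis_k_def Dis_def Suc_le_eq)
  then show "\<gamma> ! j < \<gamma> ! i" if "i < j" "j < k"
    using sorted_wrt_nth_less[of "(>)" \<gamma> i j] that by simp
  show "k \<le> \<gamma> ! i + i" if "i < k"
  proof -
    have "\<forall>g\<in>set (drop i \<gamma>). 1 \<le> g"
      using pos by (auto dest: in_set_dropD)
    then show ?thesis
      using staircase_le_sum_list[of "drop i \<gamma>" 1] \<gamma> that
      by (auto simp: sorted_wrt_drop hd_drop_conv_nth)
  qed
qed

text \<open>
  Subtracting the staircase \<open>k - 1, ..., 0\<close> from a partition with \<open>k\<close> distinct parts leaves positive,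
  weakly decreasing numbers. For the block of a split graph with clique \<open>{..<k}\<close>, these numbers are
  the degrees of the clique vertices into the stable set in the case of \<open>\<alpha>\<close>, and the numbers of stable
  vertices with at least a given degree in the case of \<open>\<beta>\<close>. The same staircase is subtracted from both,
  so majorization of the blocks turns into the dominance that the Gale-Ryser theorem asks for.
\<close>

lemma sum_excess:
  assumes "\<gamma> \<in> Dis_k k n" "m \<le> k"
  shows "(\<Sum>i<m. \<gamma> ! i - (k - 1 - i)) + (\<Sum>i<m. k - 1 - i) = psum \<gamma> m"
  using assms(2)
proof (induction m)
  case (Suc m)
  then have "psum \<gamma> (Suc m) = psum \<gamma> m + \<gamma> ! m"
    using assms(1) by (intro psum_Suc) (auto simp: Dis_k_def)
  moreover have "k \<le> \<gamma> ! m + m"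
    using Dis_k_nth_bounds(2)[OF assms(1), of m] Suc.prems by simp
  ultimately show ?case
    using Suc by simp
qed simp

lemma excess_antimono:
  assumes "\<gamma> \<in> Dis_k k n" "i \<le> j" "j < k"
  shows "\<gamma> ! j - (k - 1 - j) \<le> \<gamma> ! i - (k - 1 - i)"
  using assms(2,3)
proof (induction j rule: dec_induct)
  case (step j)
  then show ?case
    using Dis_k_nth_bounds(1)[OF assms(1), of j "Suc j"] Dis_k_nth_bounds(2)[OF assms(1), of "Suc j"]
    by simp
qed simp

text \<open>
  Every block of \<open>A_block n k\<close> comes from a split graph. The clique vertex \<open>i\<close> has degree \<open>\<alpha> ! i + i\<close>,
  which is at least \<open>k\<close>, and the vertices of the stable set have degree at most \<open>k\<close>, so only the
  former contribute to \<open>\<alpha>\<close>. Vertices of degree at least \<open>j\<close>, for \<open>0 < j \<le> k\<close>, are the clique vertices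
  and the \<open>b (j - 1)\<close> first vertices of the stable set, which produces \<open>\<beta>\<close>.
\<close>

lemma split_realization:
  assumes "(\<alpha>, \<beta>) \<in> A_block n k" "k > 0"
  defines "a i \<equiv> \<alpha> ! i - (k - 1 - i)" and "b i \<equiv> \<beta> ! i - (k - 1 - i)"
  defines "s \<equiv> b 0"
  obtains R where "\<And>i. i < k \<Longrightarrow> R i \<subseteq> {..<s}"
    "\<And>i. i < k \<Longrightarrow> 0 \<in> R i"
    "\<And>i. i < k \<Longrightarrow> card (R i) = a i" "\<And>j. card {i. i < k \<and> j \<in> R i} = card {i. i < k \<and> j < b i}"
    "\<alpha> = alpha_of (degree_sequence {..<k + s} (split_edges k R))"
    "\<beta> = beta_of (degree_sequence {..<k + s} (split_edges k R))"
proof -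
  have \<alpha>: "\<alpha> \<in> Dis_k k n" and \<beta>: "\<beta> \<in> Dis_k k n" and "\<beta> \<succeq> \<alpha>"
    using assms(1) by (auto simp: A_block_def S_Block_def)
  then have maj: "psum \<alpha> m \<le> psum \<beta> m" for m
    by (auto simp: Dis_k_def majorizes_iff_psum)
  have len: "length \<alpha> = k" "length \<beta> = k"
    using \<alpha> \<beta> by (auto simp: Dis_k_def)
  have dom: "sum a {..<m} \<le> sum b {..<m}" if "m \<le> k" for m
    using sum_excess[OF \<alpha> that] sum_excess[OF \<beta> that] maj[of m] by (simp add: a_def b_def)
  have total: "sum a {..<k} = sum b {..<k}"
  proof -
    have "psum \<alpha> k = n" "psum \<beta> k = n"
      using \<alpha> \<beta> by (auto simp: Dis_k_def Dis_psum_eq_iff)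
    then show ?thesis
      using sum_excess[OF \<alpha> order_refl] sum_excess[OF \<beta> order_refl] by (simp add: a_def b_def)
  qed
  have anti: "a j \<le> a i" "b j \<le> b i" if "i \<le> j" "j < k" for i j
    using excess_antimono[OF \<alpha> that] excess_antimono[OF \<beta> that] by (simp_all add: a_def b_def)
  have pos: "0 < b i" "0 < a i" if "i < k" for i
    using Dis_k_nth_bounds(2)[OF \<beta> that] Dis_k_nth_bounds(2)[OF \<alpha> that] that
    by (auto simp: a_def b_def)
  have ab: "a i + (k - 1) = \<alpha> ! i + i" "b i + k = \<beta> ! i + Suc i" if "i < k" for i
    using Dis_k_nth_bounds(2)[OF \<beta> that] Dis_k_nth_bounds(2)[OF \<alpha> that] that
    by (auto simp: a_def b_def)
  obtain R where R: "\<And>i. i < k \<Longrightarrow> finite (R i)" "\<And>i. i < k \<Longrightarrow> card (R i) = a i"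
    "\<And>j. card {i. i < k \<and> j \<in> R i} = card {i. i < k \<and> j < b i}"
    by (rule Gale_Ryser[of k a b]) (use anti(1) dom total in auto)
  have sub: "R i \<subseteq> {..<s}" if "i < k" for i
  proof
    fix j assume "j \<in> R i"
    then have "card {i. i < k \<and> j \<in> R i} > 0"
      using that by (subst card_gt_0_iff) auto
    then obtain i' where "i' < k" "j < b i'"
      unfolding R(3) by (subst (asm) card_gt_0_iff) auto
    then show "j \<in> {..<s}"
      using anti(2)[of 0 i'] by (simp add: s_def)
  qed
  have full: "0 \<in> R i" if "i < k" for i
  proof -
    have "{i. i < k \<and> 0 < b i} = {..<k}"
      using pos by auto
    then have "card {i. i < k \<and> 0 \<in> R i} = card {..<k}"
      by (simp add: R(3))
    then have "{i. i < k \<and> 0 \<in> R i} = {..<k}"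
      by (intro card_subset_eq) auto
    with that show ?thesis
      by auto
  qed
  let ?E = "split_edges k R"
  let ?d = "\<lambda>j. card {i. i < k \<and> j < b i}"
  have deg1: "degree ?E i = \<alpha> ! i + i" if "i < k" for i
    using degree_split_clique[OF sub that] R(2)[OF that] ab(1)[OF that] by simp
  have deg2: "degree ?E (k + j) = ?d j" for j
    using degree_split_stable[where j = j, OF sub] R(3) by simp
  have d_le: "?d j \<le> k" for j
    using card_mono[of "{..<k}" "{i. i < k \<and> j < b i}"] by auto
  have d_anti: "?d j' \<le> ?d j" if "j \<le> j'" for j j'
    using that by (intro card_mono) auto
  have deg_stable_le: "degree ?E v \<le> k" if "k \<le> v" for v
    using deg2[of "v - k"] d_le[of "v - k"] that by simp
  have deg_clique_ge: "k \<le> degree ?E v" if "v < k" for v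
    using deg1[OF that] Dis_k_nth_bounds(2)[OF \<alpha> that] by simp
  let ?\<pi> = "map (degree ?E) [0..<k + s]"
  have anti_deg: "degree ?E v \<le> degree ?E u" if "u < v" for u v
  proof (cases "v < k")
    case True
    have "a v \<le> a u"
      using anti(1)[of u v] that True by simp
    then show ?thesis
      using that True deg1 ab(1)[of u] ab(1)[of v] by simp
  next
    case False
    show ?thesis
    proof (cases "u < k")
      case True
      then show ?thesis
        using deg_stable_le[of v] deg_clique_ge[of u] False by simp
    next
      case uk: False
      then show ?thesis
        using deg2[of "u - k"] deg2[of "v - k"] d_anti[of "u - k" "v - k"] that False by simp
    qed
  qed
  then have "sorted_wrt (\<ge>) ?\<pi>"
    by (auto simp: sorted_wrt_iff_nth_less)
  then have \<pi>: "degree_sequence {..<k + s} ?E = ?\<pi>"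
    by (rule degree_sequence_lessThan)
  have pi_nth: "?\<pi> ! i = degree ?E i" if "i < k + s" for i
    using that by simp
  have "alpha_of ?\<pi> = map (\<lambda>i. \<alpha> ! i) [0..<k]"
  proof -
    have "filter (\<lambda>i. i < ?\<pi> ! i) [0..<k + s] = filter (\<lambda>i. i < k) [0..<k + s]"
    proof (rule filter_cong)
      fix i assume i: "i \<in> set [0..<k + s]"
      then have "i < k + s"
        by simp
      note pi = pi_nth[OF this]
      show "(i < ?\<pi> ! i) = (i < k)"
      proof (cases "i < k")
        case True
        then show ?thesis
          unfolding pi using deg_clique_ge[OF True] by simp
      next
        case False
        then show ?thesis
          unfolding pi using deg_stable_le[of i] by simp
      qed
    qed simp
    also have "\<dots> = [0..<k]"
      by (subst upt_add_eq_append) (auto simp: filter_id_conv filter_empty_conv)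
    finally have "filter (\<lambda>i. i < ?\<pi> ! i) [0..<k + s] = [0..<k]" .
    then have "alpha_of ?\<pi> = map (\<lambda>i. ?\<pi> ! i - i) [0..<k]"
      by (simp only: alpha_of_def length_map length_upt diff_zero)
    also have "\<dots> = map (\<lambda>i. \<alpha> ! i) [0..<k]"
    proof (rule map_cong[OF refl])
      fix i assume "i \<in> set [0..<k]"
      then have "i < k" "i < k + s"
        by auto
      then show "?\<pi> ! i - i = \<alpha> ! i"
        unfolding pi_nth[OF \<open>i < k + s\<close>] by (simp add: deg1)
    qed
    finally show ?thesis .
  qed
  moreover have "\<dots> = \<alpha>"
    using map_nth[of \<alpha>] len by simp
  ultimately have alpha: "\<alpha> = alpha_of ?\<pi>"
    by simp
  have conj: "conj_part ?\<pi> j = card {v \<in> {..<k + s}. j \<le> degree ?E v}" for j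
    using conj_part_degree_sequence[of "{..<k + s}" ?E j] \<pi> by simp
  have conj_small: "conj_part ?\<pi> (Suc j) = \<beta> ! j + Suc j" if "j < k" for j
  proof -
    have d_iff: "Suc j \<le> ?d l \<longleftrightarrow> l < b j" for l
      unfolding Suc_le_eq
    proof (rule less_card_downset_iff)
      fix i i' assume "i \<le> i'" "i' < k" "l < b i'"
      then show "l < b i"
        using anti(2)[of i i'] by simp
    qed (rule that)
    have "v < k + s \<and> Suc j \<le> degree ?E v \<longleftrightarrow> v < k + b j" for v
    proof (cases "v < k")
      case True
      then show ?thesis
        using deg_clique_ge[OF True] that by simp
    next
      case False
      then show ?thesis
        using deg2[of "v - k"] d_iff[of "v - k"] anti(2)[of 0 j] that
        by (auto simp: s_def)
    qed
    then have "{v \<in> {..<k + s}. Suc j \<le> degree ?E v} = {..<k + b j}"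
      by auto
    then show ?thesis
      using ab(2)[OF that] by (simp add: conj)
  qed
  have conj_large: "conj_part ?\<pi> j \<le> k" if "k < j" for j
  proof -
    have "{v \<in> {..<k + s}. j \<le> degree ?E v} \<subseteq> {..<k}"
    proof
      fix v assume "v \<in> {v \<in> {..<k + s}. j \<le> degree ?E v}"
      then show "v \<in> {..<k}"
        using deg_stable_le[of v] that by (cases "v < k") auto
    qed
    from card_mono[OF _ this] show ?thesis
      by (simp add: conj)
  qed
  have "beta_of ?\<pi> = map (\<lambda>j. \<beta> ! (j - 1)) [1..<k + 1]"
  proof -
    have "filter (\<lambda>j. j < conj_part ?\<pi> j) [1..<k + s + 1] = filter (\<lambda>j. j \<le> k) [1..<k + s + 1]"
    proof (rule filter_cong)
      fix j assume "j \<in> set [1..<k + s + 1]"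
      then have "0 < j"
        by (simp del: upt_Suc)
      then obtain j' where j: "j = Suc j'"
        using gr0_implies_Suc by blast
      show "(j < conj_part ?\<pi> j) = (j \<le> k)"
      proof (cases "j \<le> k")
        case True
        then have "j' < k"
          using j by simp
        from conj_small[OF this] ab(2)[OF this] pos(1)[OF this] Dis_k_nth_bounds(2)[OF \<beta> this]
        show ?thesis
          using True \<open>j' < k\<close> unfolding j by linarith
      next
        case False
        then show ?thesis
          using conj_large[of j] by simp
      qed
    qed simp
    also have "filter (\<lambda>j. j \<le> k) [1..<k + s + 1] = [1..<k + 1]"
    proof -
      have "[1..<k + s + 1] = [1..<k + 1] @ [k + 1..<k + 1 + s]"
        using upt_add_eq_append[of 1 "k + 1" s] by (simp add: ac_simps)
      then show ?thesis
        by (auto simp: filter_id_conv filter_empty_conv simp del: upt_Suc)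
    qed
    finally have "beta_of ?\<pi> = map (\<lambda>j. conj_part ?\<pi> j - j) [1..<k + 1]"
      by (simp only: beta_of_def length_map length_upt diff_zero)
    also have "\<dots> = map (\<lambda>j. \<beta> ! (j - 1)) [1..<k + 1]"
    proof (rule map_cong[OF refl])
      fix j assume "j \<in> set [1..<k + 1]"
      then have "j = Suc (j - 1)" "j - 1 < k"
        by (auto simp del: upt_Suc)
      then show "conj_part ?\<pi> j - j = \<beta> ! (j - 1)"
        using conj_small[of "j - 1"] by simp
    qed
    finally show ?thesis .
  qed
  moreover have "\<dots> = \<beta>"
    using len(2) by (intro nth_equalityI) (simp_all del: upt_Suc)
  ultimately have beta: "\<beta> = beta_of ?\<pi>"
    by simp
  show thesis
  proof (rule that)
    show "\<alpha> = alpha_of (degree_sequence {..<k + s} ?E)" "\<beta> = beta_of (degree_sequence {..<k + s} ?E)"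
      unfolding \<pi> by (rule alpha, rule beta)
  qed (use sub full R(2,3) in blast)+
qed

section \<open>NG-blocks by their smallest parts\<close>

text \<open>
  In the split graph of the block, \<open>A_set\<close> consists of the vertices of degree \<open>k\<close>. If the smallest
  part of \<open>\<alpha>\<close> is at least \<open>2\<close>, all clique vertices have larger degree and \<open>A_set\<close> lies in the stable set.
  If the smallest part of \<open>\<beta>\<close> is \<open>1\<close>, then \<open>k\<close> is the only vertex of the stable set with full degree
  \<open>k\<close>, and it forms a clique together with \<open>{..<k}\<close>.
\<close>

lemma NG_block_of_last:
  assumes A: "(\<alpha>, \<beta>) \<in> A_block n k" and "k > 0"
  shows "last \<beta> = 1 \<Longrightarrow> NG1_block (\<alpha>, \<beta>)" "last \<alpha> \<ge> 2 \<Longrightarrow> NG2_block (\<alpha>, \<beta>)"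
proof -
  define a where "a i = \<alpha> ! i - (k - 1 - i)" for i
  define b where "b i = \<beta> ! i - (k - 1 - i)" for i
  have \<alpha>: "\<alpha> \<in> Dis_k k n" and \<beta>: "\<beta> \<in> Dis_k k n"
    using A by (auto simp: A_block_def)
  define s where "s = b 0"
  obtain R where R: "\<And>i. i < k \<Longrightarrow> R i \<subseteq> {..<s}" "\<And>i. i < k \<Longrightarrow> 0 \<in> R i"
    "\<And>i. i < k \<Longrightarrow> card (R i) = a i" "\<And>j. card {i. i < k \<and> j \<in> R i} = card {i. i < k \<and> j < b i}"
    and \<pi>: "\<alpha> = alpha_of (degree_sequence {..<k + s} (split_edges k R))"
    "\<beta> = beta_of (degree_sequence {..<k + s} (split_edges k R))"
    by (rule split_realization[OF A \<open>k > 0\<close>, folded a_def b_def, folded s_def]) (rule that)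
  let ?V = "{..<k + s}" and ?E = "split_edges k R"
  have anti: "a j \<le> a i" "b j \<le> b i" if "i \<le> j" "j < k" for i j
    using excess_antimono[OF \<alpha> that] excess_antimono[OF \<beta> that] by (simp_all add: a_def b_def)
  have G: "simple_graph ?V ?E"
    by (rule simple_graph_split) (rule R(1))
  have "0 < s"
    using Dis_k_nth_bounds(2)[OF \<beta>, of 0] \<open>k > 0\<close> by (simp add: s_def b_def)
  have \<chi>: "chromatic_number ?V ?E = k + 1" "chromatic_number ?V (complement_edges ?V ?E) = s"
    using chromatic_numbers_split[of k R s] R(1,2) \<open>0 < s\<close> by blast+
  have deg1: "degree ?E i = k - 1 + a i" "0 < a i" if "i < k" for i
    using degree_split_clique[OF R(1) that] R(3)[OF that] Dis_k_nth_bounds(2)[OF \<alpha> that] that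
    by (auto simp: a_def)
  have deg2: "degree ?E (k + j) = card {i. i < k \<and> j < b i}" for j
    using degree_split_stable[where j = j, OF R(1)] R(4) by simp
  have "degree ?E v > 0" if "v \<in> ?V" for v
  proof (cases "v < k")
    case True
    then show ?thesis
      using deg1[OF True] by simp
  next
    case False
    define j where "j = v - k"
    have j: "v = k + j" "j < s"
      using False that by (auto simp: j_def)
    then show ?thesis
      unfolding j deg2 using \<open>k > 0\<close> by (subst card_gt_0_iff) (auto simp: s_def)
  qed
  then have NG: "NG_graph ?V ?E"
    using G \<chi> by (simp add: NG_graph_def)
  have A_set: "A_set ?V ?E = {v \<in> ?V. degree ?E v = k}"
    using \<chi>(1) by (simp add: A_set_def)
  have last: "last \<alpha> = a (k - 1)" "last \<beta> = b (k - 1)"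
  proof -
    have "last \<gamma> = \<gamma> ! (k - 1)" if "\<gamma> \<in> Dis_k k n" for \<gamma>
      using that \<open>k > 0\<close> by (auto simp: Dis_k_def last_conv_nth)
    from this[OF \<alpha>] this[OF \<beta>] show "last \<alpha> = a (k - 1)" "last \<beta> = b (k - 1)"
      by (simp_all add: a_def b_def)
  qed
  show "NG2_block (\<alpha>, \<beta>)" if "last \<alpha> \<ge> 2"
  proof -
    have "k \<le> v" if "degree ?E v = k" for v
    proof (rule ccontr)
      assume "\<not> k \<le> v"
      then have "v < k" "a (k - 1) \<le> a v"
        using anti(1)[of v "k - 1"] by simp_all
      then show False
        using deg1(1)[of v] that \<open>last \<alpha> \<ge> 2\<close> last(1) by linarith
    qed
    then have "stable_set ?E (A_set ?V ?E)"
      unfolding A_set stable_set_def using split_edges_stable[of k _ _ R] by blast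
    then show ?thesis
      using NG \<pi> unfolding NG2_block_def NG2_graph_def by blast
  qed
  show "NG1_block (\<alpha>, \<beta>)" if "last \<beta> = 1"
  proof -
    have "v \<le> k" if "degree ?E v = k" for v
    proof (rule ccontr)
      assume "\<not> v \<le> k"
      define j where "j = v - k"
      have j: "v = k + j" "0 < j"
        using \<open>\<not> v \<le> k\<close> by (auto simp: j_def)
      have "{i. i < k \<and> j < b i} \<subseteq> {..<k - 1}"
      proof
        fix i assume "i \<in> {i. i < k \<and> j < b i}"
        then have "i < k" "i \<noteq> k - 1"
          using \<open>last \<beta> = 1\<close> last j(2) by auto
        then show "i \<in> {..<k - 1}"
          by simp
      qed
      from card_mono[OF _ this] show False
        using deg2[of j] that j \<open>k > 0\<close> by simp
    qed
    then have "A_set ?V ?E \<subseteq> {..k}"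
      unfolding A_set by auto
    then have "clique ?E (A_set ?V ?E)"
      using clique_split[of k R, OF R(2)] unfolding clique_def by blast
    then show ?thesis
      using NG \<pi> unfolding NG1_block_def NG1_graph_def by blast
  qed
qed

lemma NG1_iff:
  assumes "(\<alpha>, \<beta>) \<in> A_block n k" "k > 0"
  shows "(\<alpha>, \<beta>) \<in> NG1 n k \<longleftrightarrow> last \<beta> = 1"
  using NG1_block_last[OF assms] NG_block_of_last(1)[OF assms] assms(1) by (auto simp: NG1_def)

lemma NG2_iff:
  assumes "(\<alpha>, \<beta>) \<in> A_block n k" "k > 0"
  shows "(\<alpha>, \<beta>) \<in> NG2 n k \<longleftrightarrow> 2 \<le> last \<alpha>"
  using NG2_block_last[OF assms] NG_block_of_last(2)[OF assms] assms(1) by (auto simp: NG2_def)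

section \<open>Meets and joins of NG-blocks\<close>

theorem theorem5p5:
  fixes n k :: nat
    and \<alpha>\<^sub>1 \<beta>\<^sub>1 \<alpha>\<^sub>2 \<beta>\<^sub>2 :: "nat list"
    and M J :: "block hatted"
  assumes "n > 0" and "k > 0" and "(k + 1) choose 2 \<le> n"
    and "(\<alpha>\<^sub>1, \<beta>\<^sub>1) \<in> S_Block n" and "(\<alpha>\<^sub>2, \<beta>\<^sub>2) \<in> S_Block n"
    and "M = Elem (\<alpha>\<^sub>1, \<beta>\<^sub>1) \<sqinter>\<^bsub>S_Block_order n\<^esub> Elem (\<alpha>\<^sub>2, \<beta>\<^sub>2)"
    and "J = Elem (\<alpha>\<^sub>1, \<beta>\<^sub>1) \<squnion>\<^bsub>S_Block_order n\<^esub> Elem (\<alpha>\<^sub>2, \<beta>\<^sub>2)"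
  shows
    "(\<forall>N \<in> {NG1 n k, NG2 n k}. (\<alpha>\<^sub>1, \<beta>\<^sub>1) \<in> N \<and> (\<alpha>\<^sub>2, \<beta>\<^sub>2) \<in> N \<longrightarrow>
        M \<in> Elem ` N \<and> (J \<in> Elem ` N \<or> J = Hat1) \<and>
        (J = Hat1 \<longleftrightarrow> \<not> (\<beta>\<^sub>1 \<sqinter>\<^bsub>Dis_order n\<^esub> \<beta>\<^sub>2) \<succeq> (\<alpha>\<^sub>1 \<squnion>\<^bsub>Dis_order n\<^esub> \<alpha>\<^sub>2))) \<and>
     (\<forall>N \<in> {NG1_star n k, NG2_star n k}. (\<alpha>\<^sub>1, \<beta>\<^sub>1) \<in> N \<and> (\<alpha>\<^sub>2, \<beta>\<^sub>2) \<in> N \<longrightarrow>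
        M \<in> Elem ` N \<and> (J \<in> Elem ` N \<or> J = Hat1) \<and>
        (J = Hat1 \<longleftrightarrow> \<not> (\<beta>\<^sub>1 \<sqinter>\<^bsub>Dis_order n\<^esub> \<beta>\<^sub>2) \<succeq> (\<alpha>\<^sub>1 \<squnion>\<^bsub>Dis_order n\<^esub> \<alpha>\<^sub>2))) \<and>
     ((\<alpha>\<^sub>1, \<beta>\<^sub>1) \<in> NG1_star n k \<and> (\<alpha>\<^sub>2, \<beta>\<^sub>2) \<in> NG2_star n k \<longrightarrow>
        M \<in> Elem ` (NG1 n k \<inter> NG2 n k) \<and> J = Hat1 \<and>
        (J = Hat1 \<longleftrightarrow> \<not> (\<beta>\<^sub>1 \<sqinter>\<^bsub>Dis_order n\<^esub> \<beta>\<^sub>2) \<succeq> (\<alpha>\<^sub>1 \<squnion>\<^bsub>Dis_order n\<^esub> \<alpha>\<^sub>2)))"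
proof (cases "(\<alpha>\<^sub>1, \<beta>\<^sub>1) \<in> A_block n k \<and> (\<alpha>\<^sub>2, \<beta>\<^sub>2) \<in> A_block n k")
  case False
  then show ?thesis
    by (auto simp: NG1_star_def NG2_star_def NG1_def NG2_def)
next
  case True
  then have A: "(\<alpha>\<^sub>1, \<beta>\<^sub>1) \<in> A_block n k" "(\<alpha>\<^sub>2, \<beta>\<^sub>2) \<in> A_block n k"
    by auto
  then have D: "\<alpha>\<^sub>1 \<in> Dis_k k n" "\<alpha>\<^sub>2 \<in> Dis_k k n" "\<beta>\<^sub>1 \<in> Dis_k k n" "\<beta>\<^sub>2 \<in> Dis_k k n"
    and maj: "\<beta>\<^sub>1 \<succeq> \<alpha>\<^sub>1" "\<beta>\<^sub>2 \<succeq> \<alpha>\<^sub>2"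
    by (auto simp: A_block_def S_Block_def)
  define \<alpha>\<^sub>M where "\<alpha>\<^sub>M = \<alpha>\<^sub>1 \<sqinter>\<^bsub>Dis_order n\<^esub> \<alpha>\<^sub>2"
  define \<beta>\<^sub>M where "\<beta>\<^sub>M = \<beta>\<^sub>1 \<squnion>\<^bsub>Dis_order n\<^esub> \<beta>\<^sub>2"
  define \<alpha>\<^sub>J where "\<alpha>\<^sub>J = \<alpha>\<^sub>1 \<squnion>\<^bsub>Dis_order n\<^esub> \<alpha>\<^sub>2"
  define \<beta>\<^sub>J where "\<beta>\<^sub>J = \<beta>\<^sub>1 \<sqinter>\<^bsub>Dis_order n\<^esub> \<beta>\<^sub>2"
  note defs = \<alpha>\<^sub>M_def[symmetric] \<beta>\<^sub>M_def[symmetric] \<alpha>\<^sub>J_def[symmetric] \<beta>\<^sub>J_def[symmetric]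
  have M: "M = Elem (\<alpha>\<^sub>M, \<beta>\<^sub>M)" "(\<alpha>\<^sub>M, \<beta>\<^sub>M) \<in> A_block n k"
    using block_meet[OF assms(1,2) A] assms(6) by (simp_all add: defs)
  have J: "J = (if \<beta>\<^sub>J \<succeq> \<alpha>\<^sub>J then Elem (\<alpha>\<^sub>J, \<beta>\<^sub>J) else Hat1)"
    "\<beta>\<^sub>J \<succeq> \<alpha>\<^sub>J \<Longrightarrow> (\<alpha>\<^sub>J, \<beta>\<^sub>J) \<in> A_block n k"
    using block_join[OF assms(1,2) A] assms(7) by (simp_all add: defs)
  have last: "last \<alpha>\<^sub>M = max (last \<alpha>\<^sub>1) (last \<alpha>\<^sub>2)" "last \<beta>\<^sub>M = min (last \<beta>\<^sub>1) (last \<beta>\<^sub>2)"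
    "last \<alpha>\<^sub>J = min (last \<alpha>\<^sub>1) (last \<alpha>\<^sub>2)" "last \<beta>\<^sub>J = max (last \<beta>\<^sub>1) (last \<beta>\<^sub>2)"
    using Dis_k_meet(2) Dis_k_join(2) D assms(1,2) by (simp_all add: \<alpha>\<^sub>M_def \<beta>\<^sub>M_def \<alpha>\<^sub>J_def \<beta>\<^sub>J_def)
  have last_le: "last \<beta>\<^sub>1 \<le> last \<alpha>\<^sub>1" "last \<beta>\<^sub>2 \<le> last \<alpha>\<^sub>2" "\<beta>\<^sub>J \<succeq> \<alpha>\<^sub>J \<Longrightarrow> last \<beta>\<^sub>J \<le> last \<alpha>\<^sub>J"
    using last_antimono D maj assms(2) J(2) by (auto simp: A_block_def)
  have pos: "0 < last \<gamma>" if "\<gamma> \<in> Dis_k k n" for \<gamma>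
    using that assms(2) by (auto simp: Dis_k_def Dis_def)
  note pos = D[THEN pos]
  \<comment> \<open>All memberships become conditions on the smallest parts. In the mixed case the first block has
    \<open>last \<alpha>\<^sub>1 = 1\<close> and the second has \<open>last \<beta>\<^sub>2 \<ge> 2\<close>, so \<open>\<beta>\<^sub>J \<succeq> \<alpha>\<^sub>J\<close> would give \<open>2 \<le> 1\<close>.\<close>
  note iffs = NG1_iff[OF A(1) assms(2)] NG1_iff[OF A(2) assms(2)] NG1_iff[OF M(2) assms(2)]
    NG2_iff[OF A(1) assms(2)] NG2_iff[OF A(2) assms(2)] NG2_iff[OF M(2) assms(2)]
  have M_iff: "M \<in> Elem ` N \<longleftrightarrow> (\<alpha>\<^sub>M, \<beta>\<^sub>M) \<in> N" for N
    using M(1) by auto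
  show ?thesis
  proof (cases "\<beta>\<^sub>J \<succeq> \<alpha>\<^sub>J")
    case True
    then have J_iff: "J \<in> Elem ` N \<longleftrightarrow> (\<alpha>\<^sub>J, \<beta>\<^sub>J) \<in> N" "J \<noteq> Hat1" for N
      using J(1) by auto
    have "last \<beta>\<^sub>J \<le> last \<alpha>\<^sub>J"
      using True by (rule last_le(3))
    then show ?thesis
      using last_le(1,2) pos True
      unfolding defs NG1_star_def NG2_star_def
      by (simp add: M_iff J_iff iffs NG1_iff[OF J(2)[OF True] assms(2)]
          NG2_iff[OF J(2)[OF True] assms(2)] last) linarith
  next
    case False
    then have "J = Hat1"
      using J(1) by simp
    then show ?thesis
      using last_le(1,2) pos False
      unfolding defs NG1_star_def NG2_star_def
      by (simp add: M_iff iffs last) linarith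
  qed
qed

end
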